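(* Let $i\in\{1,\dots,6\}$, let $\alpha>0$, and let $H=H_{i,\alpha}$ be the corresponding $p$-max stable law (with $H_{3,\alpha}:=H_3$ and $H_{6,\alpha}:=H_6$). Let $h$ be the density of $H$, $w(x)=h(x)/H(x)$ for $x$ with $0<H(x)<1$, $T(u)=H^{-1}(u)$ for $u\in(0,1)$, and $r(H)=\sup\{x: H(x)<1\}\in(-\infty,\infty]$. Let $0<x_0<1$ and let $L,\delta$ be positive constants. Let $F$ be a distribution function on $\mathbb{R}$ with Lebesgue density $f$ such that $$f(x)=w(x)e^{g(x)}\quad\text{for } T(x_0)<x<r(H),\qquad f(x)=0\quad\text{for } x>r(H),$$ where the function $g$ satisfies, for all $T(x_0)<x<r(H)$, $$|g(x)|\le\begin{cases} L(\log x)^{-\alpha\delta} & \text{if } i=1,\\ L(-\log x)^{\alpha\delta} & \text{if } i=2,\\ L\,x^{-\delta} & \text{if } i=3,\\ L(-\log(-x))^{-\alpha\delta} & \text{if } i=4,\\ L(\log(-x))^{\alpha\delta} & \text{if } i=5,\\ L|x|^{\delta} & \text{if } i=6.\end{cases}$$ For $n\ge 1$ put $F_n(x)=F\big(A_n|x|^{B_n}\operatorname{sign}(x)\big)$, $x\in\mathbb{R}$, where $$A_n=\begin{cases}1 & \text{if } i\in\{1,2,4,5\},\\ n & \text{if } i=3,\\ 1/n & \text{if } i=6,\end{cases}\qquad B_n=\begin{cases} n^{1/\alpha} & \text{if } i\in\{1,4\},\\ n^{-1/\alpha} & \text{if } i\in\{2,5\},\\ 1 & \text{if } i\in\{3,6\}.\end{cases}$$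 Then there is a constant $D$ depending only on $x_0$, $L$ and $\delta$ such that for all $n\ge1$ $$H^*(F_n^n,H)\le\begin{cases} D n^{-\delta} & \text{if } 0<\delta\le 1,\\ D n^{-1} & \text{if } \delta>1,\end{cases}$$ where $F_n^n$ denotes the distribution function $x\mapsto (F_n(x))^n$ and $H^*$ denotes the Hellinger distance.
   Context: The $p$-max stable laws, with parameter $\alpha>0$, are the distribution functions: - $H_{1,\alpha}(x)=0$ if $x\le 1$, and $\exp\{-(\log x)^{-\alpha}\}$ if $x>1$; - $H_{2,\alpha}(x)=0$ if $x<0$, $\exp\{-(-\log x)^{\alpha}\}$ if $0\le x<1$ (value $0$ at $x=0$), and $1$ if $x\ge 1$; - $H_3(x)=0$ if $x\le 0$, and $e^{-1/x}$ if $x>0$; - $H_{4,\alpha}(x)=0$ if $x\le -1$, $\exp\{-(-\log(-x))^{-\alpha}\}$ if $-1<x<0$, and $1$ if $x\ge 0$; - $H_{5,\alpha}(x)=\exp\{-(\log(-x))^{\alpha}\}$ if $x<-1$, and $1$ if $x\ge -1$; - $H_6(x)=e^{x}$ if $x\le 0$, and $1$ if $x>0$. Each is strictly increasing and continuous on $\{x:0<H(x)<1\}$, and $H^{-1}:(0,1)\to\mathbb{R}$ denotes its inverse there. $\operatorname{sign}(x)=-1,0,1$ according as $x<0$, $x=0$, $x>0$. Hellinger distance: for distribution functions $F,G$ with Lebesgue densities $f,g$, $$H^*(F,G)=\Big(\int_{-\infty}^{\infty}\big(f^{1/2}(x)-g^{1/2}(x)\big)^2\,dx\Big)^{1/2}.$$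 *)

theory Defs
  imports "HOL-Probability.Probability"
begin

text \<open>The six \<open>p\<close>-max stable laws.\<close>

definition H1 :: "real \<Rightarrow> real \<Rightarrow> real" where
  "H1 \<alpha> x = (if x \<le> 1 then 0 else exp (- (ln x powr (- \<alpha>))))"

text \<open>The value \<open>0\<close> at \<open>x = 0\<close> is part of the first branch, since \<open>ln 0 = 0\<close> in HOL.\<close>

definition H2 :: "real \<Rightarrow> real \<Rightarrow> real" where
  "H2 \<alpha> x = (if x \<le> 0 then 0 else if x < 1 then exp (- ((- ln x) powr \<alpha>)) else 1)"

definition H3 :: "real \<Rightarrow> real" where
  "H3 x = (if x \<le> 0 then 0 else exp (- 1 / x))"

definition H4 :: "real \<Rightarrow> real \<Rightarrow> real" where
  "H4 \<alpha> x = (if x \<le> - 1 then 0 else if x < 0 then exp (- ((- ln (- x)) powr (- \<alpha>))) else 1)"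

definition H5 :: "real \<Rightarrow> real \<Rightarrow> real" where
  "H5 \<alpha> x = (if x < - 1 then exp (- (ln (- x) powr \<alpha>)) else 1)"

definition H6 :: "real \<Rightarrow> real" where
  "H6 x = (if x \<le> 0 then exp x else 1)"

text \<open>The index \<open>i\<close> is meant to range over \<open>{1..6}\<close>, here and below.\<close>

definition pmax_stable :: "nat \<Rightarrow> real \<Rightarrow> real \<Rightarrow> real" where
  "pmax_stable i \<alpha> =
     (if i = 1 then H1 \<alpha>
      else if i = 2 then H2 \<alpha>
      else if i = 3 then H3
      else if i = 4 then H4 \<alpha>
      else if i = 5 then H5 \<alpha>
      else H6)"

definition quantile :: "(real \<Rightarrow> real) \<Rightarrow> real \<Rightarrow> real" where
  "quantile H = the_inv_into {x. 0 < H x \<and> H x < 1} H"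

definition right_endpoint :: "(real \<Rightarrow> real) \<Rightarrow> ereal" where
  "right_endpoint H = (SUP x\<in>{x. H x < 1}. ereal x)"

definition growth_bound :: "nat \<Rightarrow> real \<Rightarrow> real \<Rightarrow> real \<Rightarrow> real \<Rightarrow> real" where
  "growth_bound i \<alpha> L \<delta> x =
     (if i = 1 then L * ln x powr (- (\<alpha> * \<delta>))
      else if i = 2 then L * (- ln x) powr (\<alpha> * \<delta>)
      else if i = 3 then L * x powr (- \<delta>)
      else if i = 4 then L * (- ln (- x)) powr (- (\<alpha> * \<delta>))
      else if i = 5 then L * ln (- x) powr (\<alpha> * \<delta>)
      else L * \<bar>x\<bar> powr \<delta>)"

definition norm_A :: "nat \<Rightarrow> nat \<Rightarrow> real" where
  "norm_A i n = (if i = 3 then real n else if i = 6 then 1 / real n else 1)"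

definition norm_B :: "nat \<Rightarrow> real \<Rightarrow> nat \<Rightarrow> real" where
  "norm_B i \<alpha> n =
     (if i \<in> {1, 4} then real n powr (1 / \<alpha>)
      else if i \<in> {2, 5} then real n powr (- 1 / \<alpha>)
      else 1)"

definition power_normed :: "nat \<Rightarrow> real \<Rightarrow> (real \<Rightarrow> real) \<Rightarrow> nat \<Rightarrow> real \<Rightarrow> real" where
  "power_normed i \<alpha> F n x = F (norm_A i n * \<bar>x\<bar> powr norm_B i \<alpha> n * sgn x)"

definition distribution_function :: "(real \<Rightarrow> real) \<Rightarrow> bool" where
  "distribution_function F \<longleftrightarrow> (\<exists>M. real_distribution M \<and> F = cdf M)"

definition lebesgue_density :: "(real \<Rightarrow> real) \<Rightarrow> (real \<Rightarrow> real) \<Rightarrow> bool" where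
  "lebesgue_density F f \<longleftrightarrow>
     f \<in> borel_measurable borel \<and> (\<forall>x. 0 \<le> f x) \<and>
     (\<forall>x. set_integrable lborel {..x} f \<and> F x = (LBINT t:{..x}. f t))"

text \<open>Densities are unique only almost everywhere; the lemma \<open>hellinger_eq\<close> below shows that the
  choice made here is immaterial.\<close>

definition hellinger :: "(real \<Rightarrow> real) \<Rightarrow> (real \<Rightarrow> real) \<Rightarrow> real" where
  "hellinger F G =
     (let f = (SOME f. lebesgue_density F f); g = (SOME g. lebesgue_density G g)
      in sqrt (LBINT x. (sqrt (f x) - sqrt (g x))\<^sup>2))"

lemma lebesgue_density_emeasure:
  assumes "lebesgue_density F f"
  shows "emeasure (density lborel (\<lambda>x. ennreal (f x))) {..x} = ennreal (F x)"
proof -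
  have m: "f \<in> borel_measurable borel" and nn: "\<And>x. 0 \<le> f x"
    and i: "set_integrable lborel {..x} f" and F: "F x = (LBINT t:{..x}. f t)"
    using assms by (auto simp: lebesgue_density_def)
  have "emeasure (density lborel (\<lambda>x. ennreal (f x))) {..x}
      = (\<integral>\<^sup>+t. ennreal (indicator {..x} t *\<^sub>R f t) \<partial>lborel)"
    using m by (subst emeasure_density) (auto intro!: nn_integral_cong simp: indicator_def)
  also have "\<dots> = ennreal (F x)"
    unfolding F set_lebesgue_integral_def
    using i nn by (intro nn_integral_eq_integral) (auto simp: set_integrable_def)
  finally show ?thesis .
qed

lemma lebesgue_density_unique:
  assumes "lebesgue_density F f" "lebesgue_density F g"
  shows "AE x in lborel. f x = g x"
proof -
  let ?M = "\<lambda>f. density lborel (\<lambda>x. ennreal (f x))"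
  have m: "f \<in> borel_measurable borel" "g \<in> borel_measurable borel"
    and nn: "\<And>x. 0 \<le> f x" "\<And>x. 0 \<le> g x"
    using assms by (auto simp: lebesgue_density_def)
  have "?M f = ?M g"
  proof (rule measure_eqI_generator_eq[where \<Omega> = UNIV and E = "range (\<lambda>x::real. {..x})"
        and A = "\<lambda>n::nat. {..real n}"])
    show "Int_stable (range (\<lambda>x::real. {..x}))"
      by (auto simp: Int_stable_def)
    show "sets (?M f) = sigma_sets UNIV (range (\<lambda>x::real. {..x}))"
      "sets (?M g) = sigma_sets UNIV (range (\<lambda>x::real. {..x}))"
      by (auto simp: borel_eq_atMost sets_measure_of)
    show "(\<Union>n::nat. {..real n}) = UNIV"
      by (auto intro: real_arch_simple)
  qed (auto simp: lebesgue_density_emeasure[OF assms(1)] lebesgue_density_emeasure[OF assms(2)])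
  then have "AE x in lborel. ennreal (f x) = ennreal (g x)"
    using m by (subst (asm) sigma_finite_measure.density_unique_iff[OF sigma_finite_lborel]) auto
  then show ?thesis
    by eventually_elim (simp add: nn)
qed

lemma hellinger_eq:
  assumes f: "lebesgue_density F f" and g: "lebesgue_density G g"
  shows "hellinger F G = sqrt (LBINT x. (sqrt (f x) - sqrt (g x))\<^sup>2)"
proof -
  define f' where "f' = (SOME f. lebesgue_density F f)"
  define g' where "g' = (SOME g. lebesgue_density G g)"
  have f': "lebesgue_density F f'" and g': "lebesgue_density G g'"
    unfolding f'_def g'_def using someI[of "lebesgue_density F" f] someI[of "lebesgue_density G" g] f g by blast+
  have [measurable]: "f \<in> borel_measurable borel" "g \<in> borel_measurable borel"
    "f' \<in> borel_measurable borel" "g' \<in> borel_measurable borel"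
    using f g f' g' by (auto simp: lebesgue_density_def)
  have "AE x in lborel. (sqrt (f' x) - sqrt (g' x))\<^sup>2 = (sqrt (f x) - sqrt (g x))\<^sup>2"
    using lebesgue_density_unique[OF f' f] lebesgue_density_unique[OF g' g]
    by eventually_elim simp
  then have "(LBINT x. (sqrt (f' x) - sqrt (g' x))\<^sup>2) = (LBINT x. (sqrt (f x) - sqrt (g x))\<^sup>2)"
    by (intro integral_cong_AE) auto
  then show ?thesis
    by (simp add: hellinger_def Let_def f'_def g'_def)
qed

end

theory Submission
  imports Defs
begin

text \<open>A \<open>p\<close>-max stable law satisfies \<open>H (A\<^sub>n |x|^B\<^sub>n sign x) ^ n = H x\<close>, and the Hellinger
  distance is invariant under changes of variables, so the distance to be bounded is the one between
  \<open>F ^ n\<close> and \<open>H ^ n\<close>, with densities \<open>n F ^ (n - 1) f\<close> and \<open>n H ^ (n - 1) h\<close>. In terms of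
  \<open>v = - ln H\<close> all six growth bounds read \<open>|g| \<le> L v powr \<delta>\<close>; they give
  \<open>|(1 - F) - v| \<le> K v powr (1 + \<delta>)\<close> in the upper tail, where the squared difference of the root
  densities is at most \<open>n (h / H) C n powr (- 2 min \<delta> 1) exp (- c n v / 2)\<close>. As \<open>H\<close> is uniformly
  distributed under \<open>h dx\<close>, this integrates to \<open>O(n powr (- 2 min \<delta> 1))\<close>. The part below the tail is
  exponentially small in \<open>n\<close>.\<close>

subsection \<open>Distribution functions with a density\<close>

text \<open>The constant may depend only on \<open>x0\<close>, \<open>L\<close> and
  \<open>\<delta>\<close>, so the estimate must not see \<alpha>, the index \<open>i\<close> or the
  shape of \<open>h\<close>. Hence \<open>H\<close> is never differentiated: integrals against
  \<open>h\<close> or \<open>f\<close> are moved to integrals over levels in [0, 1], and \<alpha>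
  and \<open>i\<close> survive only in elementary facts about the explicit formulas. The rate comes
  from the exponents. With G = 1 - F and z = n v the root densities are, up to a common factor,
  exponentials of half of (n - 1) ln (1 - G) + g and of - z. The difference of these exponents has
  four sources: the quadratic remainder of the logarithm, of order n v^2 = z^2 / n; the error of G
  against v, n v^(1 + \<delta>) = z^(1 + \<delta>) / n^\<delta>; the factor n - 1 in place of n, v =
  z / n; and g, v^\<delta> = z^\<delta> / n^\<delta>. The first and third persist for large
  \<delta>, which is why the rate stops at 1 / n. Powers of z are harmless because both exponentials
  decay in z; for F this decay comes from the crude bound c v \<le> G.\<close>

lemma lebesgue_densityD:
  assumes "lebesgue_density F f"
  shows "f \<in> borel_measurable borel" "0 \<le> f x" "0 \<le> F x"
    "(\<integral>\<^sup>+t. ennreal (f t) * indicator {..x} t \<partial>lborel) = ennreal (F x)"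
proof -
  show m: "f \<in> borel_measurable borel" and nn: "0 \<le> f x"
    using assms by (auto simp: lebesgue_density_def)
  have nn': "0 \<le> f t" for t
    using assms by (auto simp: lebesgue_density_def)
  have "F x = (LBINT t:{..x}. f t)"
    using assms by (auto simp: lebesgue_density_def)
  then show "0 \<le> F x"
    using nn' by (simp add: set_lebesgue_integral_def)
  show "(\<integral>\<^sup>+t. ennreal (f t) * indicator {..x} t \<partial>lborel) = ennreal (F x)"
    using lebesgue_density_emeasure[OF assms, of x] m by (subst (asm) emeasure_density) auto
qed

text \<open>Nonnegative integrals spare the integrability condition: a finite value yields it,
  together with the value of the Bochner integral.\<close>

lemma lebesgue_densityI:
  assumes m: "f \<in> borel_measurable borel" and nn: "\<And>x. 0 \<le> f x" "\<And>x. 0 \<le> F x"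
    and I: "\<And>x. (\<integral>\<^sup>+t. ennreal (f t) * indicator {..x} t \<partial>lborel) = ennreal (F x)"
  shows "lebesgue_density F f"
proof -
  have "integrable lborel (\<lambda>t. f t * indicator {..x} t) \<and> (LINT t|lborel. f t * indicator {..x} t) = F x" for x
  proof (subst nn_integral_eq_integrable[symmetric])
    show "(\<integral>\<^sup>+t. ennreal (f t * indicator {..x} t) \<partial>lborel) = ennreal (F x)"
      unfolding I[symmetric] by (intro nn_integral_cong) (auto simp: indicator_def)
  qed (use m nn in auto)
  then show ?thesis
    using m nn by (simp add: lebesgue_density_def set_integrable_def set_lebesgue_integral_def mult.commute)
qed

lemma real_distribution_lebesgue_density:
  assumes d: "lebesgue_density F f" and lim: "(F \<longlongrightarrow> 1) at_top"
  shows "real_distribution (density lborel (\<lambda>x. ennreal (f x)))"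
    and "cdf (density lborel (\<lambda>x. ennreal (f x))) = F"
proof -
  let ?M = "density lborel (\<lambda>x. ennreal (f x))"
  have em: "emeasure ?M {..x} = ennreal (F x)" for x
    by (rule lebesgue_density_emeasure[OF d])
  have "(\<lambda>n. emeasure ?M {..real n}) \<longlonglongrightarrow> emeasure ?M (\<Union>n. {..real n})"
    by (intro Lim_emeasure_incseq) (auto simp: incseq_def)
  moreover have "(\<lambda>n. emeasure ?M {..real n}) \<longlonglongrightarrow> ennreal 1"
    unfolding em by (intro tendsto_intros filterlim_compose[OF lim] filterlim_real_sequentially)
  moreover have "(\<Union>n. {..real n}) = UNIV"
    by (auto intro: real_arch_simple)
  ultimately have "emeasure ?M UNIV = 1"
    by (metis LIMSEQ_unique ennreal_1)
  then interpret prob_space ?M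
    by (intro prob_spaceI) simp
  show "real_distribution ?M"
    by unfold_locales simp
  show "cdf ?M = F"
    by (auto simp: cdf_def fun_eq_iff measure_def em lebesgue_densityD[OF d])
qed

text \<open>The measure behind \<open>F\<close> supplies only the limit 1 at infinity; from then on
  the density measure represents \<open>F\<close>.\<close>

lemma distribution_function_lebesgue_density:
  assumes "lebesgue_density F f" "distribution_function F"
  shows "real_distribution (density lborel (\<lambda>x. ennreal (f x)))"
    and "cdf (density lborel (\<lambda>x. ennreal (f x))) = F"
proof -
  obtain M where "real_distribution M" "F = cdf M"
    using assms(2) by (auto simp: distribution_function_def)
  then have "(F \<longlongrightarrow> 1) at_top"
    using real_distribution.cdf_lim_at_top_prob by blast
  then show "real_distribution (density lborel (\<lambda>x. ennreal (f x)))"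
    "cdf (density lborel (\<lambda>x. ennreal (f x))) = F"
    using real_distribution_lebesgue_density[OF assms(1)] by auto
qed

lemma distribution_function_props:
  assumes "distribution_function F"
  shows "mono F" "F x \<le> 1" "F \<in> borel_measurable borel" "\<And>u. 0 < u \<Longrightarrow> \<exists>x. F x < u" "\<And>u. u < 1 \<Longrightarrow> \<exists>x. u < F x"
proof -
  obtain M where M: "real_distribution M" "F = cdf M"
    using assms by (auto simp: distribution_function_def)
  interpret real_distribution M by (rule M)
  show mono: "mono F"
    unfolding M by (intro monoI cdf_nondecreasing)
  show "F x \<le> 1" 
    unfolding M by (rule cdf_bounded_prob)
  show "F \<in> borel_measurable borel" 
    using mono by (rule borel_measurable_mono)
  show "\<exists>x. F x < u" if "0 < u" for u
    using order_tendstoD(2)[OF cdf_lim_at_bot that] eventually_happens unfolding M by fastforce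
  show "\<exists>x. u < F x" if "u < 1" for u
    using order_tendstoD(1)[OF cdf_lim_at_top_prob that] eventually_happens unfolding M by fastforce
qed

lemma continuous_on_lebesgue_density:
  assumes d: "lebesgue_density F f" and dist: "distribution_function F"
  shows "continuous_on UNIV F"
proof -
  let ?M = "density lborel (\<lambda>x. ennreal (f x))"
  interpret real_distribution ?M by (rule distribution_function_lebesgue_density[OF d dist])
  have "emeasure ?M {x} = 0" for x
    using lebesgue_densityD(1)[OF d]
    by (subst emeasure_density) (auto intro!: nn_integral_0_iff_AE[THEN iffD2] AE_I[where N="{x}"] simp: indicator_def)
  then show ?thesis
    using isCont_cdf distribution_function_lebesgue_density(2)[OF d dist]
    by (auto simp: continuous_on_eq_continuous_at measure_def)
qed

lemma distribution_function_surj: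
  assumes d: "lebesgue_density F f" and dist: "distribution_function F" and u: "0 < u" "u < 1"
  obtains x where "F x = u"
proof -
  obtain a b where ab: "F a < u" "u < F b"
    using distribution_function_props(4,5)[OF dist] u by blast
  moreover from this have "a \<le> b"
    using distribution_function_props(1)[OF dist] by (metis linorder_le_cases monoD not_le order.strict_trans)
  ultimately have "\<exists>x\<ge>a. x \<le> b \<and> F x = u"
    using continuous_on_subset[OF continuous_on_lebesgue_density[OF d dist]]
    by (intro IVT') auto
  then show ?thesis using that by blast
qed

text \<open>The probability integral transform: \<open>F\<close> pushes \<open>f dx\<close> forward
  to the uniform law, which is seen by comparing distribution functions. Since no inverse of
  \<open>F\<close> enters, \<open>F\<close> may have flat stretches.\<close>

lemma nn_integral_cdf:
  fixes K :: "real \<Rightarrow> ennreal"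
  assumes d: "lebesgue_density F f" and dist: "distribution_function F" and [measurable]: "K \<in> borel_measurable borel"
  shows "(\<integral>\<^sup>+x. K (F x) * ennreal (f x) \<partial>lborel) = (\<integral>\<^sup>+q. K q * indicator {0..1} q \<partial>lborel)"
proof -
  let ?M = "density lborel (\<lambda>x. ennreal (f x))"
  let ?U = "uniform_measure lborel {0..1::real}"
  interpret M: real_distribution ?M by (rule distribution_function_lebesgue_density[OF d dist])
  have cdf: "cdf ?M = F" by (rule distribution_function_lebesgue_density[OF d dist])
  have [measurable]: "F \<in> borel_measurable borel" "f \<in> borel_measurable borel"
    using distribution_function_props[OF dist] lebesgue_densityD[OF d] by auto
  have mono: "F x \<le> F y" if "x \<le> y" for x y
    using distribution_function_props(1)[OF dist] that by (rule monoD)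
  interpret D: real_distribution "distr ?M borel F"
    by (intro M.real_distribution_distr) simp
  have "prob_space ?U" by (intro prob_space_uniform_measure) auto
  then interpret U: prob_space ?U .
  interpret U: real_distribution ?U by unfold_locales simp
  have D01: "cdf (distr ?M borel F) u = u" if u: "0 < u" "u < 1" for u
  proof -
    let ?Z = "{x. F x \<le> u}"
    obtain b where b: "u < F b" using distribution_function_props(5)[OF dist u(2)] by blast
    have bdd: "bdd_above ?Z"
    proof (rule bdd_aboveI)
      fix x assume "x \<in> ?Z" then show "x \<le> b" using b mono[of b x] by force
    qed
    obtain y where y: "F y = u" using distribution_function_surj[OF d dist u] .
    \<comment> \<open>Continuity closes the sublevel set, so it is the half-line up to its supremum,
      where \<open>F\<close> takes the value \<open>u\<close> exactly.\<close>
    have cl: "closed ?Z"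
      using continuous_on_lebesgue_density[OF d dist] by (intro closed_Collect_le continuous_on_const)
    have S: "F (Sup ?Z) \<le> u"
      using closed_contains_Sup[OF _ bdd cl] y by auto
    have "?Z = {..Sup ?Z}"
    proof (intro equalityI subsetI)
      fix x assume "x \<in> {..Sup ?Z}"
      then show "x \<in> ?Z" using S mono[of x "Sup ?Z"] by simp
    qed (auto intro: cSup_upper bdd)
    moreover have "F (Sup ?Z) = u"
      using S mono[of y "Sup ?Z"] y cSup_upper[OF _ bdd, of y] by auto
    ultimately have "measure ?M ?Z = u"
      using cdf by (metis cdf_def)
    then show ?thesis
      by (simp add: cdf_def measure_distr vimage_def)
  qed
  have U01: "cdf ?U u = u" if u: "0 < u" "u < 1" for u
    using u by (simp add: cdf_def measure_uniform_measure Int_atLeastAtMost min_def)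
  have "cdf (distr ?M borel F) = cdf ?U"
  proof
    fix u :: real
    consider "u < 0" | "u = 0" | "0 < u" "u < 1" | "1 \<le> u" by linarith
    then show "cdf (distr ?M borel F) u = cdf ?U u"
    proof cases
      case 1
      have "F x > u" for x using lebesgue_densityD(3)[OF d, of x] 1 by simp
      then have "\<not> F x \<le> u" for x by (simp add: not_le)
      then have "F -` {..u} = {}" by auto
      then show ?thesis using 1 by (simp add: cdf_def measure_distr measure_uniform_measure)
    next
      case 3 then show ?thesis by (simp add: D01 U01)
    next
      case 4
      have "F x \<le> u" for x using distribution_function_props(2)[OF dist, of x] 4 by simp
      then have "F -` {..u} = UNIV" by auto
      moreover have "measure ?M UNIV = 1" using M.prob_space by simp
      ultimately show ?thesis using 4 by (simp add: cdf_def measure_distr measure_uniform_measure Int_atLeastAtMost)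
    next
      case 2
      \<comment> \<open>At level 0 the argument for \<open>D01\<close> breaks down, as
        \<open>F\<close> may never take the value 0; the value is squeezed from the right
        instead.\<close>
      have D0: "cdf (distr ?M borel F) 0 \<le> e" if "0 < e" for e
      proof -
        have "cdf (distr ?M borel F) 0 \<le> cdf (distr ?M borel F) (min e (1/2))"
          using that by (intro D.cdf_nondecreasing) auto
        then show ?thesis using D01[of "min e (1/2)"] that by auto
      qed
      have U0: "cdf ?U 0 \<le> e" if "0 < e" for e
      proof -
        have "cdf ?U 0 \<le> cdf ?U (min e (1/2))"
          using that by (intro U.cdf_nondecreasing) auto
        then show ?thesis using U01[of "min e (1/2)"] that by auto
      qed
      have "cdf (distr ?M borel F) 0 = 0"
        by (rule order_antisym[OF dense_ge D.cdf_nonneg]) (rule D0)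
      moreover have "cdf ?U 0 = 0"
        by (rule order_antisym[OF dense_ge U.cdf_nonneg]) (rule U0)
      ultimately show ?thesis using 2 by simp
    qed
  qed
  then have eq: "distr ?M borel F = ?U"
    by (intro cdf_unique D.real_distribution_axioms U.real_distribution_axioms)
  have "(\<integral>\<^sup>+x. K (F x) * ennreal (f x) \<partial>lborel) = (\<integral>\<^sup>+q. K q \<partial>distr ?M borel F)"
    by (simp add: nn_integral_distr nn_integral_density mult.commute)
  also have "\<dots> = (\<integral>\<^sup>+q. K q * indicator {0..1} q \<partial>lborel)"
    unfolding eq by (subst nn_integral_uniform_measure) (auto simp: divide_ennreal_def)
  finally show ?thesis .
qed

text \<open>A level set of \<open>F\<close> has no mass because a single point is null for the
  uniform law. This settles flat stretches of \<open>F\<close> and, at level 1, the region beyond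
  the right endpoint.\<close>

lemma AE_density_zero_on_level:
  assumes d: "lebesgue_density F f" and dist: "distribution_function F"
  shows "AE x in lborel. F x = b \<longrightarrow> f x = 0"
proof -
  have [measurable]: "F \<in> borel_measurable borel" "f \<in> borel_measurable borel"
    using distribution_function_props[OF dist] lebesgue_densityD[OF d] by auto
  have "(\<integral>\<^sup>+x. indicator {b} (F x) * ennreal (f x) \<partial>lborel) = (\<integral>\<^sup>+q. indicator {b} q * indicator {0..1} q \<partial>lborel)"
    by (intro nn_integral_cdf[OF d dist]) auto
  also have "\<dots> = 0"
    by (intro nn_integral_0_iff_AE[THEN iffD2] AE_I[where N="{b}"]) (auto simp: indicator_def)
  finally have "AE x in lborel. indicator {b} (F x) * ennreal (f x) = 0"
    by (subst (asm) nn_integral_0_iff_AE) auto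
  then show ?thesis
    by eventually_elim (use lebesgue_densityD(2)[OF d] in \<open>auto simp: indicator_def ennreal_eq_0_iff antisym\<close>)
qed

text \<open>By monotonicity \<open>{..y}\<close> and \<open>{x. F x \<le> F y}\<close> differ only
  inside the level set of \<open>F y\<close>, where the density vanishes almost everywhere.\<close>

lemma nn_integral_cdf_atMost:
  fixes K :: "real \<Rightarrow> ennreal"
  assumes d: "lebesgue_density F f" and dist: "distribution_function F" and [measurable]: "K \<in> borel_measurable borel"
  shows "(\<integral>\<^sup>+x. K (F x) * ennreal (f x) * indicator {..y} x \<partial>lborel) = (\<integral>\<^sup>+q. K q * indicator {0..F y} q \<partial>lborel)"
proof -
  have mono: "F x \<le> F y" if "x \<le> y" for x y
    using distribution_function_props(1)[OF dist] that by (rule monoD)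
  have "(\<integral>\<^sup>+x. K (F x) * ennreal (f x) * indicator {..y} x \<partial>lborel)
      = (\<integral>\<^sup>+x. (K (F x) * indicator {..F y} (F x)) * ennreal (f x) \<partial>lborel)"
    using AE_density_zero_on_level[OF d dist, of "F y"]
  proof (intro nn_integral_cong_AE, eventually_elim)
    fix x assume "F x = F y \<longrightarrow> f x = 0"
    then show "K (F x) * ennreal (f x) * indicator {..y} x = K (F x) * indicator {..F y} (F x) * ennreal (f x)"
      using mono[of x y] mono[of y x] by (cases "x \<le> y") (auto simp: indicator_def)
  qed
  also have "\<dots> = (\<integral>\<^sup>+q. (K q * indicator {..F y} q) * indicator {0..1} q \<partial>lborel)"
    by (intro nn_integral_cdf[OF d dist]) auto
  also have "\<dots> = (\<integral>\<^sup>+q. K q * indicator {0..F y} q \<partial>lborel)"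
    using distribution_function_props(2)[OF dist, of y]
    by (intro nn_integral_cong) (auto simp: indicator_def)
  finally show ?thesis .
qed

lemma nn_integral_cdf_greaterThan:
  fixes K :: "real \<Rightarrow> ennreal"
  assumes d: "lebesgue_density F f" and dist: "distribution_function F" and [measurable]: "K \<in> borel_measurable borel"
  shows "(\<integral>\<^sup>+x. K (F x) * ennreal (f x) * indicator {y<..} x \<partial>lborel) = (\<integral>\<^sup>+q. K q * indicator {F y..1} q \<partial>lborel)"
proof -
  have mono: "F x \<le> F y" if "x \<le> y" for x y
    using distribution_function_props(1)[OF dist] that by (rule monoD)
  have "(\<integral>\<^sup>+x. K (F x) * ennreal (f x) * indicator {y<..} x \<partial>lborel)
      = (\<integral>\<^sup>+x. (K (F x) * indicator {F y..} (F x)) * ennreal (f x) \<partial>lborel)"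
    using AE_density_zero_on_level[OF d dist, of "F y"]
  proof (intro nn_integral_cong_AE, eventually_elim)
    fix x assume "F x = F y \<longrightarrow> f x = 0"
    then show "K (F x) * ennreal (f x) * indicator {y<..} x = K (F x) * indicator {F y..} (F x) * ennreal (f x)"
      using mono[of x y] mono[of y x] by (cases "x \<le> y") (auto simp: indicator_def)
  qed
  also have "\<dots> = (\<integral>\<^sup>+q. (K q * indicator {F y..} q) * indicator {0..1} q \<partial>lborel)"
    by (intro nn_integral_cdf[OF d dist]) auto
  also have "\<dots> = (\<integral>\<^sup>+q. K q * indicator {F y..1} q \<partial>lborel)"
    using lebesgue_densityD(3)[OF d, of y]
    by (intro nn_integral_cong) (auto simp: indicator_def)
  finally show ?thesis .
qed

text \<open>Substituting \<open>q = F t\<close> leaves the integral of n q^(n - 1), so the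
  fundamental theorem is applied to a power of \<open>q\<close> and no derivative of
  \<open>F\<close> is taken.\<close>

lemma lebesgue_density_power:
  assumes d: "lebesgue_density F f" and dist: "distribution_function F" and n: "1 \<le> n"
  shows "lebesgue_density (\<lambda>x. F x ^ n) (\<lambda>x. real n * F x ^ (n - 1) * f x)"
proof (rule lebesgue_densityI)
  have [measurable]: "F \<in> borel_measurable borel" "f \<in> borel_measurable borel"
    using distribution_function_props[OF dist] lebesgue_densityD[OF d] by auto
  have nn: "0 \<le> F x" "0 \<le> f x" for x
    using lebesgue_densityD[OF d] by auto
  show "(\<lambda>x. real n * F x ^ (n - 1) * f x) \<in> borel_measurable borel" by measurable
  show "0 \<le> real n * F x ^ (n - 1) * f x" "0 \<le> F x ^ n" for x
    using nn by auto
  show "(\<integral>\<^sup>+t. ennreal (real n * F t ^ (n - 1) * f t) * indicator {..x} t \<partial>lborel) = ennreal (F x ^ n)" for x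
  proof -
    have "(\<integral>\<^sup>+t. ennreal (real n * F t ^ (n - 1) * f t) * indicator {..x} t \<partial>lborel)
        = (\<integral>\<^sup>+t. ennreal (real n * F t ^ (n - 1)) * ennreal (f t) * indicator {..x} t \<partial>lborel)"
      using nn by (intro nn_integral_cong) (auto simp: ennreal_mult')
    also have "\<dots> = (\<integral>\<^sup>+q. ennreal (real n * q ^ (n - 1)) * indicator {0..F x} q \<partial>lborel)"
      by (intro nn_integral_cdf_atMost[OF d dist]) auto
    also have "\<dots> = ennreal (F x ^ n - 0 ^ n)"
      using nn by (intro nn_integral_FTC_Icc) (auto intro!: derivative_eq_intros)
    finally show ?thesis using n by (simp add: power_0_left)
  qed
qed

lemma lebesgue_density_mono:
  assumes "lebesgue_density F f"
  shows "mono F"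
proof (rule monoI)
  fix x y :: real assume "x \<le> y"
  then have "(\<integral>\<^sup>+t. ennreal (f t) * indicator {..x} t \<partial>lborel) \<le> (\<integral>\<^sup>+t. ennreal (f t) * indicator {..y} t \<partial>lborel)"
    by (intro nn_integral_mono) (auto simp: indicator_def)
  then show "F x \<le> F y"
    using lebesgue_densityD(3,4)[OF assms] by (simp add: ennreal_le_iff)
qed

text \<open>Meant for \<open>H\<close>: its explicit inverse shows that all levels in (0, 1) are
  attained, and with monotonicity this forces the limit 1 at infinity.\<close>

lemma distribution_functionI_density:
  assumes d: "lebesgue_density F f" and le: "\<And>x. F x \<le> 1" and onto: "\<And>q. 0 < q \<Longrightarrow> q < 1 \<Longrightarrow> \<exists>x. F x = q"
  shows "distribution_function F"
proof -
  have "(F \<longlongrightarrow> 1) at_top"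
  proof (rule order_tendstoI)
    fix a :: real assume a: "a < 1"
    \<comment> \<open>The level lies strictly between \<open>max a 0\<close> and 1; the maximum
      keeps it positive when \<open>a\<close> is negative.\<close>
    obtain x where x: "F x = (max a 0 + 1) / 2" by (rule exE[OF onto[of "(max a 0 + 1) / 2"]]) (use a in auto)
    have "a < F y" if "x \<le> y" for y
      using monoD[OF lebesgue_density_mono[OF d] that] x a by (simp add: max_def split: if_splits)
    then show "eventually (\<lambda>y. a < F y) at_top"
      by (rule eventually_at_top_linorderI)
  next
    fix a :: real assume "1 < a"
    then show "eventually (\<lambda>y. F y < a) at_top"
      using le by (intro always_eventually) (meson le_less_trans)
  qed
  then show ?thesis
    using real_distribution_lebesgue_density[OF d] unfolding distribution_function_def by metis
qed

subsection \<open>Power transformations of the line\<close>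

text \<open>The argument of \<open>F\<close> in \<open>power_normed\<close>, with the norming
  constants as free parameters.\<close>

definition power_map :: "real \<Rightarrow> real \<Rightarrow> real \<Rightarrow> real" where
  "power_map A B x = A * \<bar>x\<bar> powr B * sgn x"

text \<open>The value at 0 is not claimed to be a derivative; the change of variables removes that
  point.\<close>

definition power_map_deriv :: "real \<Rightarrow> real \<Rightarrow> real \<Rightarrow> real" where
  "power_map_deriv A B x = A * B * \<bar>x\<bar> powr (B - 1)"

lemma power_map_measurable [measurable]:
  "power_map A B \<in> borel_measurable borel" "power_map_deriv A B \<in> borel_measurable borel"
  unfolding power_map_def[abs_def] power_map_deriv_def[abs_def] by measurable

lemma power_map_left_inverse:
  assumes "0 < A" "0 < B"
  shows "power_map (A powr (- 1 / B)) (1 / B) (power_map A B x) = x"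
proof (cases "x = 0")
  case False
  have "sgn (power_map A B x) = sgn x"
    using assms False by (simp add: power_map_def sgn_mult)
  moreover have "\<bar>power_map A B x\<bar> = A * \<bar>x\<bar> powr B"
    using assms False by (simp add: power_map_def abs_mult sgn_if)
  ultimately show ?thesis
    using assms False
    by (simp add: power_map_def[of _ "1 / B"] powr_mult powr_powr powr_minus abs_mult_sgn field_simps)
qed (simp add: power_map_def)

lemma power_map_right_inverse:
  assumes "0 < A" "0 < B"
  shows "power_map A B (power_map (A powr (- 1 / B)) (1 / B) y) = y"
proof -
  have "(A powr (- 1 / B)) powr (- 1 / (1 / B)) = A"
    using assms by (simp add: powr_powr)
  then show ?thesis
    using power_map_left_inverse[of "A powr (- 1 / B)" "1 / B" y] assms by simp
qed

lemma strict_mono_power_map: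
  assumes "0 < A" "0 < B"
  shows "strict_mono (power_map A B)"
proof (rule strict_monoI)
  fix x y :: real assume xy: "x < y"
  consider "0 \<le> x" | "x < 0" "0 \<le> y" | "y < 0" by linarith
  then show "power_map A B x < power_map A B y"
  proof cases
    case 1
    then show ?thesis
      using assms xy by (cases "x = 0") (auto simp: power_map_def intro!: mult_strict_left_mono powr_less_mono2)
  next
    case 2
    then have "power_map A B x < 0" "0 \<le> power_map A B y"
      using assms by (auto simp: power_map_def sgn_if)
    then show ?thesis by simp
  next
    case 3
    then show ?thesis
      using assms xy by (auto simp: power_map_def intro!: mult_strict_left_mono powr_less_mono2)
  qed
qed

lemma has_real_derivative_power_map:
  assumes "x \<noteq> 0"
  shows "(power_map A B has_real_derivative power_map_deriv A B x) (at x)"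
proof (cases "0 < x")
  case True
  have "((\<lambda>x. A * x powr B) has_real_derivative power_map_deriv A B x) (at x)"
    using True by (auto intro!: derivative_eq_intros simp: power_map_deriv_def)
  moreover have "eventually (\<lambda>t. t \<in> {0<..}) (nhds x)"
    using True by (intro eventually_nhds_in_open) auto
  then have "eventually (\<lambda>t. A * t powr B = power_map A B t) (nhds x)"
    by eventually_elim (simp add: power_map_def)
  ultimately show ?thesis
    using DERIV_cong_ev[of x x "\<lambda>x. A * x powr B" "power_map A B"] by blast
next
  case False
  then have x: "x < 0" using assms by simp
  have "((\<lambda>x. - (A * (- x) powr B)) has_real_derivative power_map_deriv A B x) (at x)"
    using x by (auto intro!: derivative_eq_intros simp: power_map_deriv_def)
  moreover have "eventually (\<lambda>t. t \<in> {..<0}) (nhds x)"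
    using x by (intro eventually_nhds_in_open) auto
  then have "eventually (\<lambda>t. - (A * (- t) powr B) = power_map A B t) (nhds x)"
    by eventually_elim (simp add: power_map_def)
  ultimately show ?thesis
    using DERIV_cong_ev[of x x "\<lambda>x. - (A * (- x) powr B)" "power_map A B"] by blast
qed

text \<open>The change of variables theorem is applied on the line without 0, where the map is
  differentiable and injective; the missing point is then restored as a null set. The theorem
  transfers absolute integrability, hence the assumption on \<open>k\<close>.\<close>

lemma nn_integral_power_map:
  fixes k :: "real \<Rightarrow> real"
  assumes A: "0 < A" "0 < B" and [measurable]: "k \<in> borel_measurable borel" and nn: "\<And>x. 0 \<le> k x"
    and fin: "integrable lborel k"
  shows "(\<integral>\<^sup>+x. ennreal (power_map_deriv A B x * k (power_map A B x)) \<partial>lborel) = (\<integral>\<^sup>+y. ennreal (k y) \<partial>lborel)"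
proof -
  let ?S = "- {0::real}"
  let ?p = "power_map A B" and ?d = "power_map_deriv A B"
  have im: "?p ` ?S = ?S"
  proof (intro equalityI subsetI)
    fix y assume "y \<in> ?S"
    moreover have "power_map A B 0 = 0" by (simp add: power_map_def)
    ultimately show "y \<in> ?p ` ?S"
      using power_map_right_inverse[OF A, of y] by (intro image_eqI[of _ _ "power_map (A powr (- 1 / B)) (1 / B) y"]) auto
  qed (use A in \<open>auto simp: power_map_def sgn_eq_0_iff\<close>)
  have d0: "0 \<le> ?d x" for x using A by (simp add: power_map_deriv_def)
  have ai: "k absolutely_integrable_on ?S"
  proof -
    have "integrable lebesgue k" using fin by (simp add: integrable_completion)
    then have "k absolutely_integrable_on UNIV" by (simp add: set_integrable_def)
    then show ?thesis by (rule set_integrable_subset) auto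
  qed
  have "(\<lambda>x. \<bar>?d x\<bar> * k (?p x)) absolutely_integrable_on ?S \<and> integral ?S (\<lambda>x. \<bar>?d x\<bar> * k (?p x)) = integral ?S k
    \<longleftrightarrow> k absolutely_integrable_on ?p ` ?S \<and> integral (?p ` ?S) k = integral ?S k"
    using strict_mono_power_map[OF A]
    by (intro has_absolute_integral_change_of_variables_1')
      (auto intro: DERIV_subset has_real_derivative_power_map simp: strict_mono_eq inj_on_def)
  then have "((\<lambda>x. ?d x * k (?p x)) has_integral integral ?S k) ?S"
    using ai im d0 by (auto simp: absolutely_integrable_on_def has_integral_integral)
  then have 1: "((\<lambda>x. ?d x * k (?p x)) has_integral integral ?S k) UNIV"
    by (subst (asm) has_integral_spike_set_eq[of _ UNIV]) (auto intro: negligible_subset[OF negligible_sing[of 0]])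
  have "(k has_integral integral ?S k) ?S"
    using ai by (auto simp: absolutely_integrable_on_def has_integral_integral)
  then have 2: "(k has_integral integral ?S k) UNIV"
    by (subst (asm) has_integral_spike_set_eq[of _ UNIV]) (auto intro: negligible_subset[OF negligible_sing[of 0]])
  have "(\<integral>\<^sup>+x. ennreal (?d x * k (?p x)) \<partial>lborel) = integral ?S k"
    using nn d0 by (intro nn_integral_has_integral_lborel[OF _ _ 1]) auto
  moreover have "(\<integral>\<^sup>+x. ennreal (k x) \<partial>lborel) = integral ?S k"
    using nn by (intro nn_integral_has_integral_lborel[OF _ _ 2]) auto
  ultimately show ?thesis by simp
qed

lemma lebesgue_density_power_map:
  assumes A: "0 < A" "0 < B" and d: "lebesgue_density F f"
  shows "lebesgue_density (\<lambda>x. F (power_map A B x)) (\<lambda>x. power_map_deriv A B x * f (power_map A B x))"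
proof (rule lebesgue_densityI)
  let ?p = "power_map A B" and ?d = "power_map_deriv A B"
  have [measurable]: "f \<in> borel_measurable borel" using lebesgue_densityD[OF d] by auto
  show "(\<lambda>x. ?d x * f (?p x)) \<in> borel_measurable borel" by measurable
  have nn: "0 \<le> F x" "0 \<le> f x" "0 \<le> ?d x" for x
    using lebesgue_densityD[OF d] A by (auto simp: power_map_deriv_def)
  show "0 \<le> ?d x * f (?p x)" "0 \<le> F (?p x)" for x
    using nn by auto
  show "(\<integral>\<^sup>+t. ennreal (?d t * f (?p t)) * indicator {..x} t \<partial>lborel) = ennreal (F (?p x))" for x
  proof -
    have "(\<integral>\<^sup>+t. ennreal (?d t * f (?p t)) * indicator {..x} t \<partial>lborel)
       = (\<integral>\<^sup>+t. ennreal (?d t * (indicator {..?p x} (?p t) * f (?p t))) \<partial>lborel)"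
      using strict_mono_power_map[OF A]
      by (intro nn_integral_cong) (auto simp: indicator_def strict_mono_less_eq)
    also have "\<dots> = (\<integral>\<^sup>+t. ennreal (indicator {..?p x} t * f t) \<partial>lborel)"
      using d nn by (intro nn_integral_power_map[OF A]) (auto simp: lebesgue_density_def set_integrable_def)
    also have "\<dots> = (\<integral>\<^sup>+t. ennreal (f t) * indicator {..?p x} t \<partial>lborel)"
      by (intro nn_integral_cong) (auto simp: indicator_def)
    finally show ?thesis using lebesgue_densityD(4)[OF d] by simp
  qed
qed

text \<open>The nonnegative Jacobian comes out of both square roots, so the squared difference
  carries it exactly once, as the change of variables requires.\<close>

lemma hellinger_power_map:
  assumes A: "0 < A" "0 < B" and d: "lebesgue_density F f" "lebesgue_density G g"
    and int: "integrable lborel (\<lambda>x. (sqrt (f x) - sqrt (g x))\<^sup>2)"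
  shows "hellinger (\<lambda>x. F (power_map A B x)) (\<lambda>x. G (power_map A B x)) = hellinger F G"
proof -
  let ?p = "power_map A B" and ?d = "power_map_deriv A B"
  have [measurable]: "f \<in> borel_measurable borel" "g \<in> borel_measurable borel" using lebesgue_densityD d by auto
  have d0: "0 \<le> ?d x" for x using A by (simp add: power_map_deriv_def)
  have "(LBINT x. (sqrt (?d x * f (?p x)) - sqrt (?d x * g (?p x)))\<^sup>2) = (LBINT x. ?d x * (sqrt (f (?p x)) - sqrt (g (?p x)))\<^sup>2)"
    using d0 by (intro Bochner_Integration.integral_cong)
      (auto simp: real_sqrt_mult power_mult_distrib right_diff_distrib[symmetric])
  also have "\<dots> = enn2real (\<integral>\<^sup>+x. ennreal (?d x * (sqrt (f (?p x)) - sqrt (g (?p x)))\<^sup>2) \<partial>lborel)"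
    using d0 by (intro integral_eq_nn_integral) auto
  also have "\<dots> = enn2real (\<integral>\<^sup>+x. ennreal ((sqrt (f x) - sqrt (g x))\<^sup>2) \<partial>lborel)"
    using int by (subst nn_integral_power_map[OF A]) auto
  also have "\<dots> = (LBINT x. (sqrt (f x) - sqrt (g x))\<^sup>2)"
    by (intro integral_eq_nn_integral[symmetric]) auto
  finally show ?thesis
    unfolding hellinger_eq[OF lebesgue_density_power_map[OF A d(1)] lebesgue_density_power_map[OF A d(2)]] hellinger_eq[OF d]
    by simp
qed

subsection \<open>The pointwise estimate\<close>

text \<open>Serves to absorb powers of z = n v into part of the exponential decay.\<close>

lemma powr_le_const_mult_exp:
  fixes p c :: real
  assumes "0 < p" "0 < c"
  shows "\<exists>C\<ge>0. \<forall>z\<ge>0. z powr p \<le> C * exp (c * z)"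
proof (intro exI conjI allI impI)
  \<comment> \<open>The constant comes from \<open>x \<le> exp x\<close> at
    \<open>x = c * z / p\<close>, raised to the power \<open>p\<close>.\<close>
  show "0 \<le> (p / c) powr p" by simp
  fix z :: real assume z: "0 \<le> z"
  have "c * z / p \<le> exp (c * z / p)"
    using exp_ge_add_one_self[of "c * z / p"] by linarith
  then have "(c * z / p) powr p \<le> exp (c * z / p) powr p"
    using assms z by (intro powr_mono2) auto
  also have "\<dots> = exp (c * z)"
    using assms by (simp add: powr_def)
  finally have "(p / c) powr p * (c * z / p) powr p \<le> (p / c) powr p * exp (c * z)"
    by (intro mult_left_mono) auto
  then show "z powr p \<le> (p / c) powr p * exp (c * z)"
    using assms z by (simp add: powr_mult[symmetric])
qed

text \<open>Since min \<delta> 1 \<le> 1, the rate n^(-2) is at least as good as the rate sought for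
  the squared distance, whatever \<delta> is.\<close>

lemma power_le_const_div_square:
  fixes \<rho> :: real
  assumes "0 \<le> \<rho>" "\<rho> < 1"
  shows "\<exists>C\<ge>0. \<forall>n\<ge>1. \<rho> ^ n \<le> C * real n powr - 2"
proof -
  obtain C where C: "C \<ge> 0" "\<And>z. 0 \<le> z \<Longrightarrow> z powr 2 \<le> C * exp ((1 - \<rho>) * z)"
    using powr_le_const_mult_exp[of 2 "1 - \<rho>"] assms by auto
  have "\<rho> ^ n \<le> C * real n powr - 2" if n: "1 \<le> n" for n
  proof -
    have "\<rho> ^ n \<le> exp (\<rho> - 1) ^ n"
      using assms exp_ge_add_one_self[of "\<rho> - 1"] by (intro power_mono) auto
    also have "\<dots> = exp (- ((1 - \<rho>) * n))"
      by (simp add: exp_of_nat_mult[symmetric] algebra_simps)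
    finally have "\<rho> ^ n * real n powr 2 \<le> exp (- ((1 - \<rho>) * n)) * (C * exp ((1 - \<rho>) * n))"
      using C(2)[of n] by (intro mult_mono) auto
    also have "\<dots> = C"
      by (simp add: exp_minus)
    finally show ?thesis
      using n by (simp add: powr_minus field_simps)
  qed
  then show ?thesis using C by blast
qed

text \<open>The mean value inequality for exp (x / 2), whose derivative is at most exp (m / 2) / 2
  below \<open>m\<close>. It reduces a difference of root densities to a difference of
  log-densities.\<close>

lemma exp_diff_square_le:
  fixes a b m :: real
  assumes "a \<le> m" "b \<le> m"
  shows "(exp (a / 2) - exp (b / 2))\<^sup>2 \<le> (a - b)\<^sup>2 * exp m / 4"
proof -
  have *: "exp (a / 2) - exp (b / 2) \<le> (a - b) / 2 * exp (m / 2)" "0 \<le> exp (a / 2) - exp (b / 2)"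
    if "b \<le> a" "a \<le> m" for a b :: real
  proof -
    have "exp (a / 2) - exp (b / 2) = exp (a / 2) * (1 - exp ((b - a) / 2))"
      by (simp add: exp_diff diff_divide_distrib algebra_simps)
    also have "\<dots> \<le> exp (a / 2) * ((a - b) / 2)"
      using exp_ge_add_one_self[of "(b - a) / 2"] by (intro mult_left_mono) (auto simp: field_simps)
    also have "\<dots> \<le> exp (m / 2) * ((a - b) / 2)"
      using that by (intro mult_right_mono) auto
    finally show "exp (a / 2) - exp (b / 2) \<le> (a - b) / 2 * exp (m / 2)" by (simp add: mult.commute)
    show "0 \<le> exp (a / 2) - exp (b / 2)" using that by simp
  qed
  have sq: "((a - b) / 2 * exp (m / 2))\<^sup>2 = (a - b)\<^sup>2 * exp m / 4" for a b
    by (simp add: power_mult_distrib power_divide exp_double[symmetric])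
  show ?thesis
  proof (cases "b \<le> a")
    case True
    then show ?thesis using power_mono[OF *[OF _ assms(1)], of b 2] unfolding sq by blast
  next
    case False
    then show ?thesis using power_mono[OF *[OF _ assms(2)], of a 2] unfolding sq
      by (simp add: power2_commute[of a] power2_commute[of "exp (a / 2)"])
  qed
qed

text \<open>Turns the bound on \<open>g\<close> into a bound on the relative error of
  \<open>f\<close> against \<open>h / H\<close>.\<close>

lemma abs_exp_minus_one_le:
  fixes x :: real
  shows "\<bar>exp x - 1\<bar> \<le> \<bar>x\<bar> * exp \<bar>x\<bar>"
proof (cases "0 \<le> x")
  case True
  have "1 - x \<le> exp (- x)" using exp_ge_add_one_self[of "- x"] by simp
  then have "exp x * (1 - x) \<le> exp x * exp (- x)" by (intro mult_left_mono) auto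
  then show ?thesis using True by (simp add: exp_minus algebra_simps)
next
  case False
  have "1 - exp x \<le> - x" using exp_ge_add_one_self[of x] by linarith
  also have "\<dots> \<le> (- x) * exp (- x)" using False by (simp add: mult_le_cancel_left1)
  finally show ?thesis using False by simp
qed

text \<open>In the variable \<open>v = - ln H\<close>, \<open>G\<close> plays the role of \<open>1 - F\<close> and \<open>\<gamma>\<close> that of \<open>g\<close>.\<close>

lemma sqrt_diff_pointwise_bound:
  fixes L \<delta> c K :: real
  assumes \<delta>: "0 < \<delta>" and L: "0 < L" and c: "0 < c" "c \<le> 1" and K: "0 \<le> K"
  shows "\<exists>C\<ge>0. \<forall>n\<ge>1. \<forall>v G \<gamma>. 0 < v \<longrightarrow> c * v \<le> G \<longrightarrow> G \<le> v / c \<longrightarrow> G \<le> 1 / 2 \<longrightarrow>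
     \<bar>G - v\<bar> \<le> K * v powr (1 + \<delta>) \<longrightarrow> \<bar>\<gamma>\<bar> \<le> L * v powr \<delta> \<longrightarrow> exp \<gamma> \<le> 1 / c \<longrightarrow>
     (sqrt ((1 - G) ^ (n - 1) * exp \<gamma>) - sqrt (exp (- (real n * v))))\<^sup>2
       \<le> C * real n powr (- 2 * min \<delta> 1) * exp (- (c * real n * v / 2))"
proof -
  let ?m = "min \<delta> 1"
  \<comment> \<open>One constant for each of the four error terms. The rate \<open>c / 4\<close> is
    chosen so that squaring costs exp (c z / 2), which uses up half of the decay exp (- c
    z).\<close>
  obtain C1 where C1: "C1 \<ge> 0" "\<And>z. 0 \<le> z \<Longrightarrow> z powr 2 \<le> C1 * exp (c / 4 * z)"
    using powr_le_const_mult_exp[of 2 "c / 4"] c by auto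
  obtain C2 where C2: "C2 \<ge> 0" "\<And>z. 0 \<le> z \<Longrightarrow> z powr (1 + \<delta>) \<le> C2 * exp (c / 4 * z)"
    using powr_le_const_mult_exp[of "1 + \<delta>" "c / 4"] c \<delta> by auto
  obtain C3 where C3: "C3 \<ge> 0" "\<And>z. 0 \<le> z \<Longrightarrow> z powr 1 \<le> C3 * exp (c / 4 * z)"
    using powr_le_const_mult_exp[of 1 "c / 4"] c by auto
  obtain C4 where C4: "C4 \<ge> 0" "\<And>z. 0 \<le> z \<Longrightarrow> z powr \<delta> \<le> C4 * exp (c / 4 * z)"
    using powr_le_const_mult_exp[of \<delta> "c / 4"] c \<delta> by auto
  define P where "P = 2 / c\<^sup>2 * C1 + K * C2 + C3 + L * C4"
  define C where "C = P\<^sup>2 * (exp (1 / 2) / c) / 4"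
  have "0 \<le> P" unfolding P_def using C1 C2 C3 C4 K L c by simp
  have "0 \<le> C" unfolding C_def using c by simp
  moreover have "(sqrt ((1 - G) ^ (n - 1) * exp \<gamma>) - sqrt (exp (- (real n * v))))\<^sup>2
       \<le> C * real n powr (- 2 * ?m) * exp (- (c * real n * v / 2))"
    if n: "1 \<le> n" and v: "0 < v" and G1: "c * v \<le> G" and G2: "G \<le> v / c" and G3: "G \<le> 1 / 2"
      and G4: "\<bar>G - v\<bar> \<le> K * v powr (1 + \<delta>)" and g1: "\<bar>\<gamma>\<bar> \<le> L * v powr \<delta>" and g2: "exp \<gamma> \<le> 1 / c"
    for n :: nat and v G \<gamma>
  proof -
    define z where "z = real n * v"
    have z: "0 \<le> z" "v = z / n" using n v by (auto simp: z_def)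
    have G0: "0 < G" using G1 v c by (meson less_le_trans mult_pos_pos)
    define a where "a = (real n - 1) * ln (1 - G) + \<gamma>"
    define b where "b = - z"
    have n1: "real (n - 1) = real n - 1" using n by auto
    have ea: "sqrt ((1 - G) ^ (n - 1) * exp \<gamma>) = exp (a / 2)"
    proof -
      have "(1 - G) ^ (n - 1) = exp ((real n - 1) * ln (1 - G))"
        using G3 n1 by (metis exp_ln exp_of_nat_mult diff_gt_0_iff_gt field_sum_of_halves order.strict_trans1 less_add_same_cancel1 half_gt_zero zero_less_one)
      then have "(1 - G) ^ (n - 1) * exp \<gamma> = exp a"
        by (simp add: a_def exp_add)
      also have "\<dots> = (exp (a / 2))\<^sup>2" by (simp add: exp_double[symmetric])
      finally show ?thesis by simp
    qed
    have eb: "sqrt (exp (- (real n * v))) = exp (b / 2)"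
    proof -
      have "exp (- (real n * v)) = (exp (b / 2))\<^sup>2" by (simp add: exp_double[symmetric] b_def z_def)
      then show ?thesis by simp
    qed
    have \<gamma>: "\<gamma> \<le> ln (1 / c)" using g2 c by (subst ln_ge_iff) auto
    \<comment> \<open>A common upper bound for both exponents: \<open>1 / 2\<close> pays for n - 1
      in place of n, since \<open>G \<le> 1 / 2\<close>, and \<open>ln (1 / c)\<close> pays for
      \<open>\<gamma>\<close>.\<close>
    define m where "m = 1 / 2 + ln (1 / c) - c * z"
    have am: "a \<le> m"
    proof -
      have "(real n - 1) * ln (1 - G) \<le> (real n - 1) * (- G)"
        using ln_le_minus_one[of "1 - G"] G3 n by (intro mult_left_mono) auto
      also have "\<dots> = - (real n * G) + G" by (simp add: algebra_simps)
      also have "\<dots> \<le> - (c * z) + 1 / 2"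
        using mult_left_mono[OF G1, of "real n"] G3 by (simp add: z_def algebra_simps)
      finally show ?thesis unfolding a_def m_def using \<gamma> by linarith
    qed
    have bm: "b \<le> m"
    proof -
      have "0 \<le> ln (1 / c)" using c by simp
      moreover have "c * z \<le> z" using c z by (simp add: mult_left_le_one_le)
      ultimately show ?thesis unfolding b_def m_def by linarith
    qed
    have em: "exp m = exp (1 / 2) / c * exp (- (c * z))"
    proof -
      have "exp m = exp (1 / 2) * exp (ln (1 / c)) * exp (- (c * z))"
        by (simp add: m_def exp_add[symmetric])
      then show ?thesis using c by simp
    qed
    have ab: "\<bar>a - b\<bar> \<le> real n powr (- ?m) * (P * exp (c / 4 * z))"
    proof -
      have "\<bar>ln (1 - G) + G\<bar> \<le> 2 * G\<^sup>2"
        using abs_ln_one_plus_x_minus_x_bound_nonpos[of "- G"] G3 G0 by simp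
      also have "\<dots> \<le> 2 * (v / c)\<^sup>2"
        using G2 G0 by (intro mult_left_mono power_mono) auto
      finally have l: "\<bar>ln (1 - G) + v\<bar> \<le> 2 * (v / c)\<^sup>2 + K * v powr (1 + \<delta>)"
        using G4 by linarith
      \<comment> \<open>The term \<open>- b\<close> is n v; pairing n - 1 copies of \<open>v\<close>
        with the logarithms leaves one copy over.\<close>
      have "a - b = (real n - 1) * (ln (1 - G) + v) + v + \<gamma>"
        by (simp add: a_def b_def z_def algebra_simps)
      then have "\<bar>a - b\<bar> \<le> \<bar>(real n - 1) * (ln (1 - G) + v)\<bar> + v + \<bar>\<gamma>\<bar>"
        using v by linarith
      also have "\<bar>(real n - 1) * (ln (1 - G) + v)\<bar> \<le> real n * (2 * (v / c)\<^sup>2 + K * v powr (1 + \<delta>))"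
        unfolding abs_mult using l n by (intro mult_mono) auto
      finally have 1: "\<bar>a - b\<bar> \<le> real n * (2 * (v / c)\<^sup>2) + K * (real n * v powr (1 + \<delta>)) + v + L * v powr \<delta>"
        using g1 by (simp add: algebra_simps)
      let ?w = "real n powr (- ?m)"
      have w1: "real n powr - 1 \<le> ?w" "real n powr - \<delta> \<le> ?w"
        by (rule powr_mono; use n in simp)+
      \<comment> \<open>Inserting \<open>v = z / n\<close> leaves n^(-1) or n^(-\<delta>) times a
        power of \<open>z\<close>, here and in the next three terms; both rates are at most
        \<open>?w\<close>.\<close>
      have "real n * (2 * (v / c)\<^sup>2) = real n powr - 1 * (2 / c\<^sup>2 * z powr 2)"
        using n v c by (simp add: z_def powr_minus field_simps power2_eq_square)
      also have "\<dots> \<le> ?w * (2 / c\<^sup>2 * (C1 * exp (c / 4 * z)))"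
        using w1 C1(2)[OF z(1)] by (intro mult_mono) auto
      finally have t1: "real n * (2 * (v / c)\<^sup>2) \<le> ?w * (2 / c\<^sup>2 * C1 * exp (c / 4 * z))" by (simp add: mult_ac)
      have "K * (real n * v powr (1 + \<delta>)) = real n powr - \<delta> * (K * z powr (1 + \<delta>))"
        using n v by (simp add: z_def powr_mult powr_add powr_minus field_simps)
      also have "\<dots> \<le> ?w * (K * (C2 * exp (c / 4 * z)))"
        using w1 C2(2)[OF z(1)] K by (intro mult_mono mult_left_mono) auto
      finally have t2: "K * (real n * v powr (1 + \<delta>)) \<le> ?w * (K * C2 * exp (c / 4 * z))" by (simp add: mult_ac)
      have "v = real n powr - 1 * z powr 1"
        using n v by (simp add: z_def powr_minus field_simps)
      also have "\<dots> \<le> ?w * (C3 * exp (c / 4 * z))"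
        using w1 C3(2)[OF z(1)] by (intro mult_mono) auto
      finally have t3: "v \<le> ?w * (C3 * exp (c / 4 * z))" .
      have "L * v powr \<delta> = real n powr - \<delta> * (L * z powr \<delta>)"
        using n v by (simp add: z_def powr_mult powr_minus field_simps)
      also have "\<dots> \<le> ?w * (L * (C4 * exp (c / 4 * z)))"
        using w1 C4(2)[OF z(1)] L by (intro mult_mono mult_left_mono) auto
      finally have t4: "L * v powr \<delta> \<le> ?w * (L * C4 * exp (c / 4 * z))" by (simp add: mult_ac)
      show ?thesis
        using 1 t1 t2 t3 t4 by (simp add: P_def algebra_simps)
    qed
    have "(exp (a / 2) - exp (b / 2))\<^sup>2 \<le> (a - b)\<^sup>2 * exp m / 4"
      by (rule exp_diff_square_le[OF am bm])
    also have "\<dots> \<le> (real n powr (- ?m) * (P * exp (c / 4 * z)))\<^sup>2 * exp m / 4"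
      using power_mono[OF ab, of 2] by (intro divide_right_mono mult_right_mono) auto
    also have "\<dots> = (real n powr (- ?m))\<^sup>2 * C * ((exp (c / 4 * z))\<^sup>2 * exp (- (c * z)))"
      unfolding em C_def by (simp add: power_mult_distrib mult_ac)
    also have "(real n powr (- ?m))\<^sup>2 = real n powr (- 2 * ?m)"
      by (simp add: power2_eq_square powr_add[symmetric])
    also have "(exp (c / 4 * z))\<^sup>2 * exp (- (c * z)) = exp (- (c * real n * v / 2))"
      by (simp add: exp_double[symmetric] exp_add[symmetric] z_def)
    finally show ?thesis unfolding ea eb by (simp add: mult_ac)
  qed
  ultimately show ?thesis by blast
qed

subsection \<open>Laws with a controlled upper tail\<close>

text \<open>The setting expressed by levels of \<open>H\<close> in place of quantiles and endpoints.
  \<open>f_0\<close> is stated almost everywhere because \<open>f\<close> is unrestricted at the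
  right endpoint itself.\<close>

locale approximate_tail =
  fixes H h F f g :: "real \<Rightarrow> real" and x0 L \<delta> :: real
  assumes x0: "0 < x0" and L: "0 < L" and \<delta>: "0 < \<delta>"
    and H: "lebesgue_density H h" "distribution_function H"
    and F: "lebesgue_density F f" "distribution_function F"
    and f_eq: "\<And>x. x0 < H x \<Longrightarrow> H x < 1 \<Longrightarrow> f x = h x / H x * exp (g x)"
    and f_0: "AE x in lborel. H x = 1 \<longrightarrow> f x = 0"
    and g_le: "\<And>x. x0 < H x \<Longrightarrow> H x < 1 \<Longrightarrow> \<bar>g x\<bar> \<le> L * (- ln (H x)) powr \<delta>"
begin

text \<open>On the tail - ln H stays below - ln x0, so \<open>c\<close> and \<open>1 / c\<close>
  enclose exp g. Only \<open>x0\<close>, \<open>L\<close> and \<open>\<delta>\<close> enter, which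
  keeps the final constant uniform.\<close>

definition c :: real where "c = exp (- (L * (- ln x0) powr \<delta>))"

lemma c_bounds: "0 < c" "c \<le> 1"
  using L by (auto simp: c_def)

lemma measurable_functions [measurable]:
  "H \<in> borel_measurable borel" "h \<in> borel_measurable borel"
  "F \<in> borel_measurable borel" "f \<in> borel_measurable borel"
  using distribution_function_props(3) lebesgue_densityD(1) H F by auto

lemma nonneg: "0 \<le> H x" "0 \<le> h x" "0 \<le> F x" "0 \<le> f x" "H x \<le> 1" "F x \<le> 1"
  using lebesgue_densityD(2,3) distribution_function_props(2) H F by auto

lemma mono_H: "x \<le> y \<Longrightarrow> H x \<le> H y"
  using distribution_function_props(1)[OF H(2)] by (rule monoD)

lemma exp_g_bounds:
  assumes "x0 < H x" "H x < 1"
  shows "exp \<bar>g x\<bar> \<le> 1 / c" "c \<le> exp (g x)" "exp (g x) \<le> 1 / c"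
proof -
  have "\<bar>g x\<bar> \<le> L * (- ln (H x)) powr \<delta>" by (rule g_le[OF assms])
  also have "\<dots> \<le> L * (- ln x0) powr \<delta>"
    using assms x0 L \<delta> by (intro mult_left_mono powr_mono2) auto
  finally have *: "\<bar>g x\<bar> \<le> L * (- ln x0) powr \<delta>" .
  have "exp \<bar>g x\<bar> \<le> exp (L * (- ln x0) powr \<delta>)" using * by simp
  also have "\<dots> = 1 / c" by (simp add: c_def exp_minus field_simps)
  finally show "exp \<bar>g x\<bar> \<le> 1 / c" .
  then show "exp (g x) \<le> 1 / c"
    using exp_le_cancel_iff[of "g x" "\<bar>g x\<bar>"] by linarith
  show "c \<le> exp (g x)"
    using * unfolding c_def exp_le_cancel_iff by linarith
qed

text \<open>Formally \<open>h / H\<close> is the derivative of ln H; the transform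
  \<open>q = H x\<close> makes this rigorous through the integral of 1 / q. So - ln H is the tail
  mass that \<open>f\<close> would have if \<open>g\<close> were 0.\<close>

lemma hazard_integral:
  assumes y: "0 < H y"
  shows "integrable lborel (\<lambda>x. h x / H x * indicator {y<..} x)"
    and "(LBINT x. h x / H x * indicator {y<..} x) = - ln (H y)"
proof -
  have "(\<integral>\<^sup>+x. ennreal (h x / H x * indicator {y<..} x) \<partial>lborel)
     = (\<integral>\<^sup>+x. ennreal (1 / H x) * ennreal (h x) * indicator {y<..} x \<partial>lborel)"
    using nonneg by (intro nn_integral_cong) (auto simp: indicator_def ennreal_mult'[symmetric])
  also have "\<dots> = (\<integral>\<^sup>+q. ennreal (1 / q) * indicator {H y..1} q \<partial>lborel)"
    by (intro nn_integral_cdf_greaterThan[OF H]) auto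
  also have "\<dots> = ennreal (ln 1 - ln (H y))"
    using y nonneg by (intro nn_integral_FTC_Icc) (auto intro!: derivative_eq_intros)
  finally have "(\<integral>\<^sup>+x. ennreal (h x / H x * indicator {y<..} x) \<partial>lborel) = ennreal (- ln (H y))" by simp
  then have "integrable lborel (\<lambda>x. h x / H x * indicator {y<..} x) \<and> (LBINT x. h x / H x * indicator {y<..} x) = - ln (H y)"
    using y nonneg by (subst (asm) nn_integral_eq_integrable) (auto intro!: AE_I2)
  then show "integrable lborel (\<lambda>x. h x / H x * indicator {y<..} x)"
    "(LBINT x. h x / H x * indicator {y<..} x) = - ln (H y)" by auto
qed

lemma upper_tail_integral:
  shows "integrable lborel (\<lambda>x. f x * indicator {y<..} x)"
    and "(LBINT x. f x * indicator {y<..} x) = 1 - F y"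
proof -
  have "(\<integral>\<^sup>+x. ennreal (f x * indicator {y<..} x) \<partial>lborel)
     = (\<integral>\<^sup>+x. 1 * ennreal (f x) * indicator {y<..} x \<partial>lborel)"
    by (intro nn_integral_cong) (auto simp: indicator_def)
  also have "\<dots> = (\<integral>\<^sup>+q. 1 * indicator {F y..1} q \<partial>lborel)"
    by (intro nn_integral_cdf_greaterThan[OF F]) auto
  also have "\<dots> = ennreal (1 - F y)"
    using nonneg by simp
  finally have "integrable lborel (\<lambda>x. f x * indicator {y<..} x) \<and> (LBINT x. f x * indicator {y<..} x) = 1 - F y"
    using nonneg by (subst (asm) nn_integral_eq_integrable) (auto intro!: AE_I2)
  then show "integrable lborel (\<lambda>x. f x * indicator {y<..} x)"
    "(LBINT x. f x * indicator {y<..} x) = 1 - F y" by auto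
qed

text \<open>Each claim is the integral of a pointwise comparison of \<open>f\<close> with
  \<open>h / H\<close>, whose integral beyond \<open>y\<close> is \<open>v\<close>. For the last
  one, - ln H does not increase, so \<open>v\<close> controls \<open>g\<close> everywhere beyond
  \<open>y\<close>.\<close>

lemma upper_tail_bounds:
  assumes y: "x0 < H y" "H y < 1"
  defines "v \<equiv> - ln (H y)"
  shows "c * v \<le> 1 - F y" "1 - F y \<le> v / c" "\<bar>(1 - F y) - v\<bar> \<le> L / c * v powr (1 + \<delta>)"
proof -
  let ?W = "\<lambda>x. h x / H x * indicator {y<..} x"
  let ?J = "\<lambda>x. f x * indicator {y<..} x"
  have y0: "0 < H y" using y x0 by simp
  have v: "0 < v" using y y0 by (simp add: v_def)
  note W = hazard_integral[OF y0, folded v_def]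
  note J = upper_tail_integral[of y]
  have AE: "AE x in lborel. c * ?W x \<le> ?J x \<and> ?J x \<le> ?W x / c \<and> \<bar>?J x - ?W x\<bar> \<le> ?W x * (L / c * v powr \<delta>)"
    using f_0 AE_density_zero_on_level[OF H, of 1]
  proof eventually_elim
    case (elim x)
    show ?case
    proof (cases "y < x \<and> H x < 1")
      \<comment> \<open>Where \<open>H x = 1\<close>, both densities vanish almost everywhere; up to
        \<open>y\<close>, the indicators do.\<close>
      case False
      then have "?W x = 0" "?J x = 0"
        using elim nonneg(5)[of x] by (cases "y < x"; auto)+
      then show ?thesis by (simp only: mult_zero_left mult_zero_right div_0 abs_zero diff_self order_refl simp_thms)
    next
      case True
      then have Hx: "x0 < H x" "H x < 1" "H y \<le> H x"
        using y(1) mono_H[of y x] by linarith+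
      have w: "0 \<le> h x / H x" using nonneg by simp
      have eq: "?W x = h x / H x" "?J x = h x / H x * exp (g x)"
        using True f_eq[OF Hx(1,2)] by simp_all
      have "\<bar>exp (g x) - 1\<bar> \<le> \<bar>g x\<bar> * exp \<bar>g x\<bar>" by (rule abs_exp_minus_one_le)
      also have "\<dots> \<le> (L * (- ln (H x)) powr \<delta>) * (1 / c)"
        using g_le[OF Hx(1,2)] exp_g_bounds(1)[OF Hx(1,2)] by (intro mult_mono) auto
      also have "\<dots> \<le> (L * v powr \<delta>) * (1 / c)"
        using Hx x0 y0 c_bounds L \<delta> unfolding v_def by (intro mult_right_mono mult_left_mono powr_mono2) auto
      finally have "\<bar>exp (g x) - 1\<bar> \<le> L / c * v powr \<delta>" by simp
      then have "h x / H x * \<bar>exp (g x) - 1\<bar> \<le> h x / H x * (L / c * v powr \<delta>)"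
        using w by (rule mult_left_mono)
      moreover have "\<bar>?J x - ?W x\<bar> = h x / H x * \<bar>exp (g x) - 1\<bar>"
      proof -
        have "h x / H x * exp (g x) - h x / H x = h x / H x * (exp (g x) - 1)"
          by (simp add: right_diff_distrib)
        then show ?thesis unfolding eq using w by (simp only: abs_mult abs_of_nonneg)
      qed
      moreover have "c * (h x / H x) \<le> h x / H x * exp (g x)"
        using mult_left_mono[OF exp_g_bounds(2)[OF Hx(1,2)] w] by (simp add: mult.commute)
      moreover have "h x / H x * exp (g x) \<le> h x / H x / c"
        using mult_left_mono[OF exp_g_bounds(3)[OF Hx(1,2)] w] by simp
      ultimately show ?thesis unfolding eq by simp
    qed
  qed
  have "(LBINT x. c * ?W x) \<le> (LBINT x. ?J x)"
    using AE by (intro integral_mono_AE integrable_mult_right W(1) J(1)) (auto elim: eventually_mono)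
  then show "c * v \<le> 1 - F y" unfolding J(2) integral_mult_right_zero W(2) .
  have "(LBINT x. ?J x) \<le> (LBINT x. ?W x / c)"
    using AE by (intro integral_mono_AE integrable_divide W(1) J(1)) (auto elim: eventually_mono)
  then show "1 - F y \<le> v / c" unfolding J(2) integral_divide_zero W(2) .
  have "\<bar>(1 - F y) - v\<bar> = \<bar>LBINT x. ?J x - ?W x\<bar>"
    by (simp only: Bochner_Integration.integral_diff[OF J(1) W(1)] J(2) W(2))
  also have "\<dots> \<le> (LBINT x. \<bar>?J x - ?W x\<bar>)" by (rule integral_abs_bound)
  also have "\<dots> \<le> (LBINT x. ?W x * (L / c * v powr \<delta>))"
    using AE by (intro integral_mono_AE integrable_abs Bochner_Integration.integrable_diff integrable_mult_left W(1) J(1))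
      (auto elim: eventually_mono)
  also have "\<dots> = v * (L / c * v powr \<delta>)" unfolding integral_mult_left_zero W(2) ..
  also have "\<dots> = L / c * v powr (1 + \<delta>)" using v by (simp add: powr_add)
  finally show "\<bar>(1 - F y) - v\<bar> \<le> L / c * v powr (1 + \<delta>)" .
qed

text \<open>The root densities are not compared here: (sqrt a - sqrt b)^2 \<le> a + b, and the two
  densities integrate to \<open>F y ^ n\<close> and \<open>H y ^ n\<close>.\<close>

lemma lower_part:
  assumes n: "1 \<le> n"
  shows "(\<integral>\<^sup>+x. ennreal ((sqrt (real n * F x ^ (n - 1) * f x) - sqrt (real n * H x ^ (n - 1) * h x))\<^sup>2) * indicator {..y} x \<partial>lborel)
     \<le> ennreal (F y ^ n + H y ^ n)"
proof -
  have sq: "(sqrt a - sqrt b)\<^sup>2 \<le> a + b" if "0 \<le> a" "0 \<le> b" for a b :: real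
    using that by (simp add: power2_diff)
  have "(\<integral>\<^sup>+x. ennreal ((sqrt (real n * F x ^ (n - 1) * f x) - sqrt (real n * H x ^ (n - 1) * h x))\<^sup>2) * indicator {..y} x \<partial>lborel)
     \<le> (\<integral>\<^sup>+x. ennreal (real n * F x ^ (n - 1) * f x) * indicator {..y} x + ennreal (real n * H x ^ (n - 1) * h x) * indicator {..y} x \<partial>lborel)"
    using nonneg by (intro nn_integral_mono) (auto simp: indicator_def ennreal_plus[symmetric] simp del: ennreal_plus intro!: ennreal_leI sq)
  also have "\<dots> = ennreal (F y ^ n) + ennreal (H y ^ n)"
    using lebesgue_densityD(4)[OF lebesgue_density_power[OF F n]] lebesgue_densityD(4)[OF lebesgue_density_power[OF H n]]
    by (subst nn_integral_add) auto
  finally show ?thesis using nonneg by (simp add: ennreal_plus)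
qed

text \<open>Both densities share the factor n h / H; what remains is the pointwise estimate with G =
  1 - F and \<gamma> = g, which is then integrated over levels. The second condition on
  \<open>y\<close> ensures 1 - F \<le> 1 / 2 beyond it.\<close>

lemma upper_part:
  assumes n: "1 \<le> n" and y: "x0 < H y" "- ln (H y) \<le> c / 2" and C: "0 \<le> C"
    and pw: "\<And>v G \<gamma>. \<lbrakk>0 < v; c * v \<le> G; G \<le> v / c; G \<le> 1 / 2;
      \<bar>G - v\<bar> \<le> L / c * v powr (1 + \<delta>); \<bar>\<gamma>\<bar> \<le> L * v powr \<delta>; exp \<gamma> \<le> 1 / c\<rbrakk> \<Longrightarrow>
     (sqrt ((1 - G) ^ (n - 1) * exp \<gamma>) - sqrt (exp (- (real n * v))))\<^sup>2
       \<le> C * real n powr (- 2 * min \<delta> 1) * exp (- (c * real n * v / 2))"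
  shows "(\<integral>\<^sup>+x. ennreal ((sqrt (real n * F x ^ (n - 1) * f x) - sqrt (real n * H x ^ (n - 1) * h x))\<^sup>2) * indicator {y<..} x \<partial>lborel)
     \<le> ennreal (2 * C / c * real n powr (- 2 * min \<delta> 1))"
proof -
  \<comment> \<open>With this exponent exp (- c n v / 2) becomes \<open>H x powr a\<close>, and the
    factor 1 / a produced by integration cancels the last \<open>n\<close> in
    \<open>D\<close>.\<close>
  define a where "a = c * real n / 2"
  have a: "0 < a" using c_bounds n by (simp add: a_def)
  define D where "D = C * real n powr (- 2 * min \<delta> 1) * real n"
  have D: "0 \<le> D" using C by (simp add: D_def)
  have y0: "0 < H y" using y(1) x0 by linarith
  have "AE x in lborel. ennreal ((sqrt (real n * F x ^ (n - 1) * f x) - sqrt (real n * H x ^ (n - 1) * h x))\<^sup>2) * indicator {y<..} x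
     \<le> ennreal (D * H x powr (a - 1)) * ennreal (h x) * indicator {y<..} x"
    using f_0 AE_density_zero_on_level[OF H, of 1]
  proof eventually_elim
    case (elim x)
    consider "x \<le> y" | "y < x" "H x = 1" | "y < x" "H x < 1" using nonneg(5)[of x] by linarith
    then show ?case
    proof cases
      case 1
      then show ?thesis by simp
    next
      case 2
      then have "f x = 0" "h x = 0" using elim by blast+
      then show ?thesis by simp
    next
      case 3
      then have Hx: "x0 < H x" "H x < 1" "H y \<le> H x" "0 < H x"
        using y(1) y0 mono_H[of y x] by linarith+
      define v where "v = - ln (H x)"
      have v: "0 < v" using Hx by (simp add: v_def)
      have vy: "v \<le> c / 2" using ln_mono[OF Hx(3) y0] y(2) Hx(4) unfolding v_def by linarith
      have G: "1 - F x \<le> 1 / 2"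
      proof -
        have "v / c \<le> 1 / 2" using vy c_bounds by (simp add: field_simps)
        then show ?thesis using upper_tail_bounds(2)[OF Hx(1,2)] unfolding v_def by linarith
      qed
      have p: "(sqrt (F x ^ (n - 1) * exp (g x)) - sqrt (exp (- (real n * v))))\<^sup>2
         \<le> C * real n powr (- 2 * min \<delta> 1) * exp (- (c * real n * v / 2))"
        using pw[OF v upper_tail_bounds(1,2)[OF Hx(1,2), folded v_def] G
            upper_tail_bounds(3)[OF Hx(1,2), folded v_def] g_le[OF Hx(1,2), folded v_def] exp_g_bounds(3)[OF Hx(1,2)]]
        by simp
      define w where "w = real n * (h x / H x)"
      have w: "0 \<le> w" using nonneg by (simp add: w_def)
      have HH: "exp (- (real n * v)) = H x ^ n"
        using Hx by (simp add: v_def exp_of_nat_mult)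
      have "H x ^ n = H x * H x ^ (n - 1)"
        using n by (cases n) auto
      then have e2: "real n * H x ^ (n - 1) * h x = w * exp (- (real n * v))"
        unfolding HH w_def using Hx by simp
      have e1: "real n * F x ^ (n - 1) * f x = w * (F x ^ (n - 1) * exp (g x))"
        using f_eq[OF Hx(1,2)] by (simp add: w_def)
      have "(sqrt (real n * F x ^ (n - 1) * f x) - sqrt (real n * H x ^ (n - 1) * h x))\<^sup>2
          = w * (sqrt (F x ^ (n - 1) * exp (g x)) - sqrt (exp (- (real n * v))))\<^sup>2"
        unfolding e1 e2 using w
        by (simp only: real_sqrt_mult[of w] right_diff_distrib[symmetric] power_mult_distrib real_sqrt_pow2)
      also have "\<dots> \<le> w * (C * real n powr (- 2 * min \<delta> 1) * exp (- (c * real n * v / 2)))"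
        using p w by (rule mult_left_mono)
      also have "exp (- (c * real n * v / 2)) = H x powr a"
        using Hx by (simp add: powr_def a_def v_def)
      also have "w * (C * real n powr (- 2 * min \<delta> 1) * H x powr a) = D * H x powr (a - 1) * h x"
        using Hx by (simp add: w_def D_def powr_diff)
      finally show ?thesis
        using 3 D nonneg by (simp add: ennreal_mult'[symmetric] ennreal_leI)
    qed
  qed
  then have "(\<integral>\<^sup>+x. ennreal ((sqrt (real n * F x ^ (n - 1) * f x) - sqrt (real n * H x ^ (n - 1) * h x))\<^sup>2) * indicator {y<..} x \<partial>lborel)
     \<le> (\<integral>\<^sup>+x. ennreal (D * H x powr (a - 1)) * ennreal (h x) * indicator {y<..} x \<partial>lborel)"
    by (rule nn_integral_mono_AE)
  also have "\<dots> = (\<integral>\<^sup>+q. ennreal (D * q powr (a - 1)) * indicator {H y..1} q \<partial>lborel)"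
    by (intro nn_integral_cdf_greaterThan[OF H]) auto
  \<comment> \<open>The exponent \<open>a - 1\<close> may be negative, but the range of integration
    starts at \<open>H y > 0\<close>.\<close>
  also have "\<dots> = ennreal (D / a * 1 powr a - D / a * H y powr a)"
    using y0 nonneg a D by (intro nn_integral_FTC_Icc) (auto intro!: derivative_eq_intros)
  also have "\<dots> \<le> ennreal (2 * C / c * real n powr (- 2 * min \<delta> 1))"
  proof (rule ennreal_leI)
    have "D / a = 2 * C / c * real n powr (- 2 * min \<delta> 1)"
      using n c_bounds by (simp add: a_def D_def)
    moreover have "0 \<le> D / a * H y powr a" using D a by simp
    ultimately show "D / a * 1 powr a - D / a * H y powr a \<le> 2 * C / c * real n powr (- 2 * min \<delta> 1)"
      unfolding powr_one_eq_one mult_1_right by linarith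
  qed
  finally show ?thesis .
qed

end

text \<open>All constants are fixed before \<open>H\<close>, \<open>F\<close> and \<open>n\<close>
  appear; this order of quantifiers is what makes \<open>D\<close> uniform.\<close>

lemma power_density_distance_bound:
  assumes x0: "0 < x0" "x0 < 1" and L: "0 < L" and \<delta>: "0 < \<delta>"
  shows "\<exists>C\<ge>0. \<forall>H h F f g n. approximate_tail H h F f g x0 L \<delta> \<longrightarrow> 1 \<le> n \<longrightarrow>
    (\<integral>\<^sup>+x. ennreal ((sqrt (real n * F x ^ (n - 1) * f x) - sqrt (real n * H x ^ (n - 1) * h x))\<^sup>2) \<partial>lborel)
      \<le> ennreal (C * real n powr (- 2 * min \<delta> 1))"
proof -
  \<comment> \<open>The constant \<open>c\<close> of the locale, written out because it is needed
    before any \<open>H\<close> and \<open>F\<close> are given.\<close>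
  define k where "k = exp (- (L * (- ln x0) powr \<delta>))"
  have k: "0 < k" "k \<le> 1" using L by (auto simp: k_def)
  \<comment> \<open>The cut is made at the fixed level exp (- t): the first bound puts it strictly
    inside the tail, the second makes 1 - F \<le> 1 / 2 beyond it.\<close>
  define t where "t = min (- ln x0 / 2) (k / 2)"
  have t: "0 < t" "t \<le> - ln x0 / 2" "t \<le> k / 2" using x0 k by (auto simp: t_def)
  have "t < - ln x0" using t x0 by simp
  then have q0: "x0 < exp (- t)" using x0 by (metis exp_less_cancel_iff exp_ln less_minus_iff)
  \<comment> \<open>Keeps the base \<open>1 - k * t\<close> of a geometric sequence
    nonnegative.\<close>
  have ct: "k * t \<le> 1"
  proof -
    have "t \<le> 1" using t k by simp
    then show ?thesis using k t mult_mono[of k 1 t 1] by simp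
  qed
  obtain C1 where C1: "C1 \<ge> 0" and pw: "\<And>n v G \<gamma>. \<lbrakk>1 \<le> n; 0 < v; k * v \<le> G; G \<le> v / k; G \<le> 1 / 2;
      \<bar>G - v\<bar> \<le> L / k * v powr (1 + \<delta>); \<bar>\<gamma>\<bar> \<le> L * v powr \<delta>; exp \<gamma> \<le> 1 / k\<rbrakk> \<Longrightarrow>
     (sqrt ((1 - G) ^ (n - 1) * exp \<gamma>) - sqrt (exp (- (real n * v))))\<^sup>2
       \<le> C1 * real n powr (- 2 * min \<delta> 1) * exp (- (k * real n * v / 2))"
    using sqrt_diff_pointwise_bound[OF \<delta> L k, of "L / k"] L k by (force simp del: One_nat_def)
  obtain C2 where C2: "C2 \<ge> 0" "\<And>n. 1 \<le> n \<Longrightarrow> (1 - k * t) ^ n \<le> C2 * real n powr - 2"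
    using power_le_const_div_square[of "1 - k * t"] k t ct by auto
  obtain C3 where C3: "C3 \<ge> 0" "\<And>n. 1 \<le> n \<Longrightarrow> exp (- t) ^ n \<le> C3 * real n powr - 2"
    using power_le_const_div_square[of "exp (- t)"] t by auto
  define C where "C = C2 + C3 + 2 * C1 / k"
  have "0 \<le> C" using C1 C2 C3 k by (simp add: C_def)
  moreover have "(\<integral>\<^sup>+x. ennreal ((sqrt (real n * F x ^ (n - 1) * f x) - sqrt (real n * H x ^ (n - 1) * h x))\<^sup>2) \<partial>lborel)
      \<le> ennreal (C * real n powr (- 2 * min \<delta> 1))"
    if tail: "approximate_tail H h F f g x0 L \<delta>" and n: "1 \<le> n" for H h F f g n
  proof -
    interpret approximate_tail H h F f g x0 L \<delta> by (rule tail)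
    have cc: "approximate_tail.c x0 L \<delta> = k" unfolding k_def by (rule approximate_tail.c_def[OF tail])
    let ?I = "\<lambda>x. ennreal ((sqrt (real n * F x ^ (n - 1) * f x) - sqrt (real n * H x ^ (n - 1) * h x))\<^sup>2)"
    let ?w = "real n powr (- 2 * min \<delta> 1)"
    obtain y where y: "H y = exp (- t)"
      using distribution_function_surj[OF H, of "exp (- t)"] t by auto
    have w: "real n powr - 2 \<le> ?w" using n by (intro powr_mono) auto
    \<comment> \<open>The tail bound at the cut itself keeps \<open>F y\<close> below 1 by a fixed
      amount, and this is enough to the left of \<open>y\<close>, where \<open>F\<close> may be
      badly behaved.\<close>
    have "1 - F y \<ge> k * t"
      using upper_tail_bounds(1)[of y] y q0 t unfolding cc by simp
    then have Fn: "F y ^ n \<le> (1 - k * t) ^ n"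
      using nonneg by (intro power_mono) auto
    have "(\<integral>\<^sup>+x. ?I x \<partial>lborel) = (\<integral>\<^sup>+x. ?I x * indicator {..y} x + ?I x * indicator {y<..} x \<partial>lborel)"
      by (intro nn_integral_cong) (auto simp: indicator_def)
    also have "\<dots> = (\<integral>\<^sup>+x. ?I x * indicator {..y} x \<partial>lborel) + (\<integral>\<^sup>+x. ?I x * indicator {y<..} x \<partial>lborel)"
      by (intro nn_integral_add) auto
    also have "\<dots> \<le> ennreal (F y ^ n + H y ^ n) + ennreal (2 * C1 / k * ?w)"
      using lower_part[OF n, of y] upper_part[OF n, of y C1, unfolded cc] pw[OF n] y q0 t C1
      by (intro add_mono) auto
    also have "\<dots> \<le> ennreal (C2 * ?w + C3 * ?w) + ennreal (2 * C1 / k * ?w)"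
    proof (intro add_mono ennreal_leI order_refl)
      show "F y ^ n \<le> C2 * ?w"
        using Fn C2(2)[OF n] mult_left_mono[OF w C2(1)] by linarith
      show "H y ^ n \<le> C3 * ?w"
        unfolding y using C3(2)[OF n] mult_left_mono[OF w C3(1)] by linarith
    qed
    also have "\<dots> = ennreal (C2 * ?w + C3 * ?w + 2 * C1 / k * ?w)"
      using C1 C2 C3 k by (intro ennreal_plus[symmetric]) auto
    also have "\<dots> = ennreal (C * ?w)" by (simp add: C_def algebra_simps)
    finally show ?thesis .
  qed
  ultimately show ?thesis by blast
qed

subsection \<open>The six stable laws\<close>

lemma exp_minus_divide_power:
  "1 \<le> n \<Longrightarrow> exp (- (v / real n)) ^ n = exp (- v)"
  by (simp add: exp_of_nat_mult[symmetric])

text \<open>The factors are those of \<open>norm_B\<close>: they divide - ln H by n, which the n-th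
  power of \<open>H\<close> multiplies back.\<close>

lemma scaled_powr:
  fixes t \<alpha> :: real
  assumes "0 < \<alpha>" "1 \<le> n" "0 \<le> t"
  shows "(real n powr (1 / \<alpha>) * t) powr - \<alpha> = t powr - \<alpha> / real n"
    and "(real n powr (- 1 / \<alpha>) * t) powr \<alpha> = t powr \<alpha> / real n"
proof -
  have "(real n powr (1 / \<alpha>)) powr - \<alpha> = 1 / real n" "(real n powr (- 1 / \<alpha>)) powr \<alpha> = 1 / real n"
    using assms by (simp_all only: powr_powr) (simp_all add: powr_minus_divide)
  then show "(real n powr (1 / \<alpha>) * t) powr - \<alpha> = t powr - \<alpha> / real n"
    "(real n powr (- 1 / \<alpha>) * t) powr \<alpha> = t powr \<alpha> / real n"
    using assms by (simp_all only: powr_mult) simp_all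
qed

lemma pmax_stable_cases:
  assumes "i \<in> {1..6::nat}"
  obtains "i = 1" "pmax_stable i \<alpha> = H1 \<alpha>" | "i = 2" "pmax_stable i \<alpha> = H2 \<alpha>" | "i = 3" "pmax_stable i \<alpha> = H3"
    | "i = 4" "pmax_stable i \<alpha> = H4 \<alpha>" | "i = 5" "pmax_stable i \<alpha> = H5 \<alpha>" | "i = 6" "pmax_stable i \<alpha> = H6"
proof -
  consider "i = 1" | "i = 2" | "i = 3" | "i = 4" | "i = 5" | "i = 6"
    using assms by fastforce
  then show ?thesis
    by cases (use that in \<open>auto simp: pmax_stable_def\<close>)
qed

lemma pmax_stable_le_1:
  assumes "i \<in> {1..6}"
  shows "pmax_stable i \<alpha> x \<le> 1"
  using pmax_stable_cases[OF assms, of \<alpha>]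
  by cases (auto simp: H1_def H2_def H3_def H4_def H5_def H6_def)

text \<open>In the laws with a parameter \<alpha>, the power \<alpha> * \<delta> is the \<delta>-th
  power of the power \<alpha> that defines - ln H; with this \<alpha> leaves the estimate.\<close>

lemma growth_bound_eq:
  assumes i: "i \<in> {1..6}" and \<alpha>: "0 < \<alpha>" and H: "0 < pmax_stable i \<alpha> x" "pmax_stable i \<alpha> x < 1"
  shows "growth_bound i \<alpha> L \<delta> x = L * (- ln (pmax_stable i \<alpha> x)) powr \<delta>"
  using pmax_stable_cases[OF i, of \<alpha>]
proof cases
  case 1
  then show ?thesis using H \<alpha> by (auto simp: H1_def growth_bound_def powr_powr split: if_splits)
next
  case 2
  then show ?thesis using H \<alpha> by (auto simp: H2_def growth_bound_def powr_powr split: if_splits)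
next
  case 3
  then show ?thesis using H \<alpha> by (auto simp: H3_def growth_bound_def powr_divide powr_minus_divide split: if_splits)
next
  case 4
  then show ?thesis using H \<alpha> by (auto simp: H4_def growth_bound_def powr_powr split: if_splits)
next
  case 5
  then show ?thesis using H \<alpha> by (auto simp: H5_def growth_bound_def powr_powr split: if_splits)
next
  case 6
  then show ?thesis using H \<alpha> by (auto simp: H6_def growth_bound_def split: if_splits)
qed

lemma norm_pos:
  assumes "1 \<le> n"
  shows "0 < norm_A i n" "0 < norm_B i \<alpha> n"
  using assms by (auto simp: norm_A_def norm_B_def)

text \<open>Where 0 < H < 1, norming divides - ln H by n and the n-th power undoes it. The cases
  locate \<open>x\<close> relative to the points where \<open>H\<close> reaches 0 or 1, which the
  power map preserves.\<close>

lemma pmax_stability: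
  assumes i: "i \<in> {1..6}" and \<alpha>: "0 < \<alpha>" and n: "1 \<le> n"
  shows "pmax_stable i \<alpha> (power_map (norm_A i n) (norm_B i \<alpha> n) x) ^ n = pmax_stable i \<alpha> x"
proof -
  have ln0: "0 < real n powr b" for b using n by simp
  have one_lt: "1 < t powr real n powr b \<longleftrightarrow> 1 < t" if "0 < t" for t b :: real
  proof -
    have "1 < t powr (real n powr b) \<longleftrightarrow> 0 < real n powr b * ln t"
      using that by (simp add: powr_def)
    then show ?thesis using ln0[of b] that by (simp add: zero_less_mult_iff)
  qed
  have lt_one: "t powr real n powr b < 1 \<longleftrightarrow> t < 1" if "0 < t" for t b :: real
  proof -
    have "t powr (real n powr b) < 1 \<longleftrightarrow> real n powr b * ln t < 0"
      using that by (simp add: powr_def)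
    then show ?thesis using ln0[of b] that by (simp add: mult_less_0_iff)
  qed
  note defs = power_map_def norm_A_def norm_B_def
  note s = scaled_powr[OF \<alpha> n] exp_minus_divide_power[OF n]
  show ?thesis
    using pmax_stable_cases[OF i, of \<alpha>]
  proof cases
    case 1
    consider "1 < x" | "0 < x" "x \<le> 1" | "x \<le> 0" by linarith
    then show ?thesis
    proof cases
      case a: 1
      then show ?thesis
        using 1 one_lt[of x "1 / \<alpha>"] s(1)[of "ln x"] s(3) by (simp add: defs H1_def ln_powr not_le)
    next
      case a: 2
      then show ?thesis
        using 1 one_lt[of x "1 / \<alpha>"] n by (simp add: defs H1_def not_less)
    next
      case a: 3
      then have "- (\<bar>x\<bar> powr b) \<le> 1" for b by (rule_tac order_trans[of _ 0]) auto
      then show ?thesis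
        using 1 a n by (simp add: defs H1_def sgn_if)
    qed
  next
    case 2
    consider "1 \<le> x" | "0 < x" "x < 1" | "x \<le> 0" by linarith
    then show ?thesis
    proof cases
      case a: 1
      then show ?thesis
        using 2 lt_one[of x "- 1 / \<alpha>"] by (simp add: defs H2_def)
    next
      case a: 2
      then show ?thesis
        using 2 lt_one[of x "- 1 / \<alpha>"] s(2)[of "- ln x"] s(3) by (simp add: defs H2_def ln_powr)
    next
      case a: 3
      then have "power_map (norm_A i n) (norm_B i \<alpha> n) x \<le> 0"
        using 2 by (auto simp: defs sgn_if)
      then show ?thesis
        using 2 a n by (simp add: H2_def)
    qed
  next
    case 3
    consider "0 < x" | "x \<le> 0" by linarith
    then show ?thesis
    proof cases
      case a: 1
      then show ?thesis
        using 3 n s(3)[of "1 / x"] by (simp add: defs H3_def mult.commute mult_le_0_iff)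
    next
      case a: 2
      then show ?thesis
        using 3 n by (simp add: defs H3_def sgn_if mult_le_0_iff)
    qed
  next
    case 4
    consider "0 \<le> x" | "- 1 < x" "x < 0" | "x \<le> - 1" by linarith
    then show ?thesis
    proof cases
      case a: 1
      have "- 1 < x powr b" for b by (rule less_le_trans[of _ 0]) auto
      then show ?thesis
        using 4 a by (simp add: defs H4_def sgn_if not_le)
    next
      case a: 2
      then show ?thesis
        using 4 lt_one[of "- x" "1 / \<alpha>"] s(1)[of "- ln (- x)"] s(3) by (simp add: defs H4_def ln_powr)
    next
      case a: 3
      then show ?thesis
        using 4 n lt_one[of "- x" "1 / \<alpha>"] by (simp add: defs H4_def)
    qed
  next
    case 5
    consider "0 \<le> x" | "- 1 \<le> x" "x < 0" | "x < - 1" by linarith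
    then show ?thesis
    proof cases
      case a: 1
      have "\<not> x powr b < - 1" for b by (rule leD, rule order_trans[of _ 0]) auto
      then show ?thesis
        using 5 a by (simp add: defs H5_def sgn_if)
    next
      case a: 2
      then show ?thesis
        using 5 one_lt[of "- x" "- 1 / \<alpha>"] by (simp add: defs H5_def)
    next
      case a: 3
      then show ?thesis
        using 5 one_lt[of "- x" "- 1 / \<alpha>"] s(2)[of "ln (- x)"] s(3) by (simp add: defs H5_def ln_powr)
    qed
  next
    case 6
    consider "0 < x" | "x \<le> 0" by linarith
    then show ?thesis
    proof cases
      case a: 1
      then show ?thesis
        using 6 n by (simp add: defs H6_def sgn_if divide_le_0_iff)
    next
      case a: 2
      then show ?thesis
        using 6 n s(3)[of "- x"] by (auto simp: defs H6_def sgn_if)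
    qed
  qed
qed

text \<open>The witness solves - ln H = - ln q in each law. The first property gives all levels in
  (0, 1), the second the injectivity on which \<open>the_inv_into\<close> in \<open>quantile\<close>
  relies.\<close>

lemma pmax_stable_inverse:
  assumes i: "i \<in> {1..6}" and \<alpha>: "0 < \<alpha>"
  shows "\<exists>u. (\<forall>q. 0 < q \<and> q < 1 \<longrightarrow> pmax_stable i \<alpha> (u q) = q) \<and>
    (\<forall>x. 0 < pmax_stable i \<alpha> x \<and> pmax_stable i \<alpha> x < 1 \<longrightarrow> u (pmax_stable i \<alpha> x) = x)"
  using pmax_stable_cases[OF i, of \<alpha>]
proof cases
  case 1
  show ?thesis
    by (rule exI[of _ "\<lambda>q. exp ((- ln q) powr (- 1 / \<alpha>))"])
      (use 1 \<alpha> in \<open>auto simp: H1_def powr_powr not_le split: if_splits\<close>)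
next
  case 2
  show ?thesis
    by (rule exI[of _ "\<lambda>q. exp (- ((- ln q) powr (1 / \<alpha>)))"])
      (use 2 \<alpha> in \<open>auto simp: H2_def powr_powr split: if_splits\<close>)
next
  case 3
  show ?thesis
    by (rule exI[of _ "\<lambda>q. - 1 / ln q"])
      (use 3 in \<open>auto simp: H3_def not_le field_simps split: if_splits\<close>)
next
  case 4
  show ?thesis
    by (rule exI[of _ "\<lambda>q. - exp (- ((- ln q) powr (- 1 / \<alpha>)))"])
      (use 4 \<alpha> in \<open>auto simp: H4_def powr_powr split: if_splits\<close>)
next
  case 5
  show ?thesis
    by (rule exI[of _ "\<lambda>q. - exp ((- ln q) powr (1 / \<alpha>))"])
      (use 5 \<alpha> in \<open>auto simp: H5_def powr_powr split: if_splits\<close>)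
next
  case 6
  show ?thesis
    by (rule exI[of _ "\<lambda>q. ln q"]) (use 6 in \<open>auto simp: H6_def split: if_splits\<close>)
qed

text \<open>Monotonicity of \<open>H\<close> turns positions relative to the quantile and the right
  endpoint into levels relative to \<open>x0\<close> and 1.\<close>

lemma approximate_tailI:
  assumes x0: "0 < x0" "x0 < 1" and L: "0 < L" and \<delta>: "0 < \<delta>" and i: "i \<in> {1..6::nat}" and \<alpha>: "0 < \<alpha>"
    and H: "H = pmax_stable i \<alpha>" "lebesgue_density H h"
    and w: "\<And>x. 0 < H x \<Longrightarrow> H x < 1 \<Longrightarrow> w x = h x / H x"
    and F: "distribution_function F" "lebesgue_density F f"
    and f: "\<And>x. quantile H x0 < x \<Longrightarrow> ereal x < right_endpoint H \<Longrightarrow> f x = w x * exp (g x)"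
    and f0: "\<And>x. right_endpoint H < ereal x \<Longrightarrow> f x = 0"
    and g: "\<And>x. quantile H x0 < x \<Longrightarrow> ereal x < right_endpoint H \<Longrightarrow> \<bar>g x\<bar> \<le> growth_bound i \<alpha> L \<delta> x"
  shows "approximate_tail H h F f g x0 L \<delta>"
proof -
  obtain u where u1: "\<And>q. 0 < q \<Longrightarrow> q < 1 \<Longrightarrow> H (u q) = q"
    and u2: "\<And>x. 0 < H x \<Longrightarrow> H x < 1 \<Longrightarrow> u (H x) = x"
    using pmax_stable_inverse[OF i \<alpha>] unfolding H(1)[symmetric] by blast
  have le1: "H x \<le> 1" for x unfolding H(1) by (rule pmax_stable_le_1[OF i])
  have dist: "distribution_function H"
    using u1 le1 by (intro distribution_functionI_density[OF H(2)]) blast+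
  have mono: "H x \<le> H y" if "x \<le> y" for x y
    using lebesgue_density_mono[OF H(2)] that by (rule monoD)
  let ?S = "{x. 0 < H x \<and> H x < 1}"
  have inj: "inj_on H ?S"
    using u2 by (intro inj_on_inverseI[where g = u]) simp
  have "x0 \<in> H ` ?S"
    using u1[OF x0] x0 by (intro image_eqI[of _ _ "u x0"]) auto
  then have T: "H (quantile H x0) = x0"
    unfolding quantile_def by (rule f_the_inv_into_f[OF inj])
  have range: "quantile H x0 < x" "ereal x < right_endpoint H" if x: "x0 < H x" "H x < 1" for x
  proof -
    show "quantile H x0 < x"
      using mono[of x "quantile H x0"] T x by (metis leD linorder_le_less_linear)
    \<comment> \<open>A point halfway in level between \<open>H x\<close> and 1 still counts in the
      supremum, so the endpoint lies strictly beyond \<open>x\<close>.\<close>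
    define y where "y = u ((H x + 1) / 2)"
    have y: "H y = (H x + 1) / 2" unfolding y_def using x x0 by (intro u1) auto
    have "x < y"
    proof (rule ccontr)
      assume "\<not> x < y"
      then show False using mono[of y x] x unfolding y by simp
    qed
    moreover have "ereal y \<le> right_endpoint H"
      unfolding right_endpoint_def using y x by (intro SUP_upper) auto
    ultimately show "ereal x < right_endpoint H"
      by (meson less_ereal.simps(1) less_le_trans)
  qed
  show ?thesis
  proof
    show "f x = h x / H x * exp (g x)" if "x0 < H x" "H x < 1" for x
      using f[OF range[OF that]] w[of x] that x0 by simp
    show "\<bar>g x\<bar> \<le> L * (- ln (H x)) powr \<delta>" if "x0 < H x" "H x < 1" for x
      using g[OF range[OF that]] growth_bound_eq[OF i \<alpha>, of x L \<delta>] that x0 unfolding H(1)[symmetric] by simp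
    \<comment> \<open>At a finite right endpoint \<open>f\<close> is unrestricted, so this point is
      dropped. For an infinite endpoint \<open>real_of_ereal\<close> returns 0, and dropping 0 does
      no harm.\<close>
    have "AE x in lborel. x \<noteq> real_of_ereal (right_endpoint H)"
      by (intro AE_I[where N = "{real_of_ereal (right_endpoint H)}"]) auto
    then show "AE x in lborel. H x = 1 \<longrightarrow> f x = 0"
    proof (eventually_elim, intro impI)
      fix x assume x: "x \<noteq> real_of_ereal (right_endpoint H)" "H x = 1"
      have "right_endpoint H \<le> ereal x"
        unfolding right_endpoint_def
      proof (rule SUP_least)
        fix y assume "y \<in> {x. H x < 1}"
        then show "ereal y \<le> ereal x" using mono[of x y] x by force
      qed
      moreover have "right_endpoint H \<noteq> ereal x" using x by auto
      ultimately show "f x = 0" by (intro f0) auto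
    qed
  qed (use x0 L \<delta> H F dist in auto)
qed

theorem theorem2:
  fixes x0 L \<delta> :: real
  assumes "0 < x0" "x0 < 1" "0 < L" "0 < \<delta>"
  shows "\<exists>D::real.
    \<forall>i \<alpha> H h w T r F f g.
      i \<in> {1..6::nat} \<and> 0 < \<alpha> \<and>
      H = pmax_stable i \<alpha> \<and>
      lebesgue_density H h \<and>
      (\<forall>x. 0 < H x \<and> H x < 1 \<longrightarrow> w x = h x / H x) \<and>
      T = quantile H \<and>
      r = right_endpoint H \<and>
      distribution_function F \<and> lebesgue_density F f \<and>
      (\<forall>x. T x0 < x \<and> ereal x < r \<longrightarrow> f x = w x * exp (g x)) \<and>
      (\<forall>x. r < ereal x \<longrightarrow> f x = 0) \<and>
      (\<forall>x. T x0 < x \<and> ereal x < r \<longrightarrow> \<bar>g x\<bar> \<le> growth_bound i \<alpha> L \<delta> x)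
      \<longrightarrow> (\<forall>n\<ge>1.
            hellinger (\<lambda>x. power_normed i \<alpha> F n x ^ n) H
              \<le> (if \<delta> \<le> 1 then D * real n powr (- \<delta>) else D / real n))"
proof -
  obtain C where C: "0 \<le> C" and bound: "\<And>H h F f g n. approximate_tail H h F f g x0 L \<delta> \<Longrightarrow> 1 \<le> n \<Longrightarrow>
    (\<integral>\<^sup>+x. ennreal ((sqrt (real n * F x ^ (n - 1) * f x) - sqrt (real n * H x ^ (n - 1) * h x))\<^sup>2) \<partial>lborel)
      \<le> ennreal (C * real n powr (- 2 * min \<delta> 1))"
    using power_density_distance_bound[OF assms] by blast
  show ?thesis
  \<comment> \<open>\<open>C\<close> governs the squared distance and was fixed before the law and
    \<open>F\<close>, so its root can serve as \<open>D\<close>.\<close>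
  proof (rule exI[of _ "sqrt C"], intro allI impI, elim conjE)
    fix i :: nat and \<alpha> :: real and H h w T :: "real \<Rightarrow> real" and r :: ereal and F f g :: "real \<Rightarrow> real" and n :: nat
    assume n: "1 \<le> n" and i: "i \<in> {1..6}" and \<alpha>: "0 < \<alpha>" and H: "H = pmax_stable i \<alpha>" "lebesgue_density H h"
      and w: "\<forall>x. 0 < H x \<and> H x < 1 \<longrightarrow> w x = h x / H x" and T: "T = quantile H" and r: "r = right_endpoint H"
      and F: "distribution_function F" "lebesgue_density F f"
      and f: "\<forall>x. T x0 < x \<and> ereal x < r \<longrightarrow> f x = w x * exp (g x)" "\<forall>x. r < ereal x \<longrightarrow> f x = 0"
      and g: "\<forall>x. T x0 < x \<and> ereal x < r \<longrightarrow> \<bar>g x\<bar> \<le> growth_bound i \<alpha> L \<delta> x"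
    have tail: "approximate_tail H h F f g x0 L \<delta>"
      using w f g unfolding T r by (intro approximate_tailI[where w = w, OF assms i \<alpha> H _ F]) auto
    have dist: "distribution_function H" using tail by (simp add: approximate_tail_def)
    let ?A = "norm_A i n" and ?B = "norm_B i \<alpha> n"
    let ?I = "\<lambda>x. (sqrt (real n * F x ^ (n - 1) * f x) - sqrt (real n * H x ^ (n - 1) * h x))\<^sup>2"
    note dF = lebesgue_density_power[OF F(2,1) n] and dH = lebesgue_density_power[OF H(2) dist n]
    have meas: "?I \<in> borel_measurable borel"
      using lebesgue_densityD(1)[OF dF] lebesgue_densityD(1)[OF dH] by measurable
    \<comment> \<open>The bound on the nonnegative integral is used twice: its finiteness licenses
      the change of variables, its value gives the rate.\<close>
    have "integrable lborel ?I"
    proof (rule integrableI_nonneg)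
      show "(\<integral>\<^sup>+x. ennreal (?I x) \<partial>lborel) < \<infinity>"
        using bound[OF tail n] by (rule le_less_trans) simp
    qed (use meas in auto)
    then have "hellinger (\<lambda>x. F (power_map ?A ?B x) ^ n) (\<lambda>x. H (power_map ?A ?B x) ^ n) = hellinger (\<lambda>x. F x ^ n) (\<lambda>x. H x ^ n)"
      by (intro hellinger_power_map[OF norm_pos[OF n] dF dH])
    moreover have "(\<lambda>x. H (power_map ?A ?B x) ^ n) = H"
      unfolding H(1) using pmax_stability[OF i \<alpha> n] by blast
    moreover have "power_normed i \<alpha> F n x = F (power_map ?A ?B x)" for x
      by (simp add: power_normed_def power_map_def)
    ultimately have "hellinger (\<lambda>x. power_normed i \<alpha> F n x ^ n) H = sqrt (LBINT x. ?I x)"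
      using hellinger_eq[OF dF dH] by simp
    also have "\<dots> \<le> sqrt (C * real n powr (- 2 * min \<delta> 1))"
      using integral_real_bounded[OF _ bound[OF tail n]] C by simp
    also have "real n powr (- 2 * min \<delta> 1) = (real n powr (- min \<delta> 1))\<^sup>2"
      by (simp add: power2_eq_square powr_add[symmetric])
    also have "sqrt (C * (real n powr (- min \<delta> 1))\<^sup>2) = sqrt C * real n powr (- min \<delta> 1)"
      by (simp add: real_sqrt_mult)
    also have "\<dots> = (if \<delta> \<le> 1 then sqrt C * real n powr (- \<delta>) else sqrt C / real n)"
      using n by (simp add: powr_minus_divide)
    finally show "hellinger (\<lambda>x. power_normed i \<alpha> F n x ^ n) H
              \<le> (if \<delta> \<le> 1 then sqrt C * real n powr (- \<delta>) else sqrt C / real n)" .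
  qed
qed

end
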